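(* Let $\mu$ be a fixed positive, $\sigma$-finite, non-atomic Borel measure supported in an interval $J=[0,\alpha]$, where $\alpha$ may be finite or infinite, and let $W^{(\mu)}$ be the corresponding generalized Brownian motion. For a given continuous function $\varphi$ on $\mathbb{R}$, set $$u(t,x)=\big(S_t^{(\mu)}\varphi\big)(x)=\mathbb{E}_x\big(\varphi(W_t^{(\mu)})\big),\qquad t\in\mathbb{R}_+ .$$ Then $$\nabla_t^{(\mu)}u=\frac12\,\frac{\partial^2}{\partial x^2}u .$$
   Context: $W^{(\mu)}$ is the real-valued Gaussian process determined by $\mathbb{E}(W_A^{(\mu)})=0$ and $\mathbb{E}(W_A^{(\mu)}W_B^{(\mu)})=\mu(A\cap B)$ for all Borel sets $A,B\subset J$. For $A=[s,t]$ a choice of $W_t^{(\mu)}$ is made such that $W_{[s,t]}^{(\mu)}=W_t^{(\mu)}-W_s^{(\mu)}$. The probability space $\Omega$ consists of continuous paths $\omega$, and $W_t^{(\mu)}(\omega)=\omega(t)$. The conditional expectation $\mathbb{E}_x$ corresponds to the condition $W_0^{(\mu)}=x$, so that $u(0,x)=\varphi(x)$. Since $W^{(\mu)}$ has independent increments, $S_t^{(\mu)}$, $t\in\mathbb{R}_+$, is a Markov semigroup. $\nabla_t^{(\mu)}$ is the operator $d/d\mu$ acting in the $t$ variable, where for a function $f$ locally of bounded variation the Radon-Nikodym derivative $\nabla^{(\mu)}f=df/d\mu$ of its Stieltjes measure is determined by $f(b)-f(a)=\int_a^b(\nabla^{(\mu)}f)\,d\mu$.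
   Formalization: Assumes μ([0,t]) finite and φ(W_t) integrable for all t, x, so that W_t and u exist; on intervals reaching times with μ([0,t])=0 the equation is asserted only if u(·,x) is locally of bounded variation there, which can fail for merely continuous φ; elsewhere it is unconditional. *)

theory Defs
  imports "HOL-Probability.Probability"
begin

section \<open>Measures on a time interval\<close>

text \<open>The interval \<open>[0, \<alpha>]\<close> inside the real line; it is \<open>[0, \<infinity>)\<close> when \<open>\<alpha> = \<infinity>\<close>.\<close>

definition time_interval :: "ereal \<Rightarrow> real set" where
  "time_interval \<alpha> = {t. 0 \<le> t \<and> ereal t \<le> \<alpha>}"

definition measure_atom :: "'a measure \<Rightarrow> 'a set \<Rightarrow> bool" where
  "measure_atom M A \<longleftrightarrow>
     A \<in> sets M \<and> 0 < emeasure M A \<and>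
     (\<forall>B\<in>sets M. B \<subseteq> A \<and> emeasure M B < emeasure M A \<longrightarrow> emeasure M B = 0)"

definition non_atomic :: "'a measure \<Rightarrow> bool" where
  "non_atomic M \<longleftrightarrow> \<not> (\<exists>A. measure_atom M A)"


section \<open>Gaussian processes and generalized Brownian motion\<close>

text \<open>Constants count as (degenerate) Gaussian random variables.\<close>

definition gaussian_rv :: "'w measure \<Rightarrow> ('w \<Rightarrow> real) \<Rightarrow> bool" where
  "gaussian_rv M X \<longleftrightarrow>
     X \<in> borel_measurable M \<and>
     ((\<exists>m. AE \<omega> in M. X \<omega> = m) \<or>
      (\<exists>m \<sigma>. 0 < \<sigma> \<and> distributed M lborel X (\<lambda>y. ennreal (normal_density m \<sigma> y))))"

definition gaussian_process :: "'w measure \<Rightarrow> 'i set \<Rightarrow> ('i \<Rightarrow> 'w \<Rightarrow> real) \<Rightarrow> bool" where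
  "gaussian_process M I X \<longleftrightarrow>
     (\<forall>F c. finite F \<and> F \<subseteq> I \<longrightarrow> gaussian_rv M (\<lambda>\<omega>. \<Sum>i\<in>F. c i * X i \<omega>))"

text \<open>Continuous paths on \<open>[0, \<infinity>)\<close>, with the \<open>\<sigma>\<close>-algebra generated by the coordinate
  maps \<open>\<omega> \<mapsto> \<omega> t\<close>. Only the measurable structure of this space is used.\<close>

definition path_space :: "(real \<Rightarrow> real) measure" where
  "path_space = restrict_space (\<Pi>\<^sub>M t\<in>{0..}. borel) {\<omega>. continuous_on {0..} \<omega>}"

text \<open>\<open>P x\<close> is the law of the paths conditioned to start at \<open>x\<close>, and \<open>W\<close> is the process indexed
  by the Borel subsets of \<open>J\<close> of finite \<open>\<mu>\<close>-measure (for the others the prescribed variance would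
  be infinite). The coordinate process \<open>W\<^sub>t(\<omega>) = \<omega> t\<close> runs over all of \<open>[0, \<infinity>)\<close>. Since
  \<open>\<mu>\<close> lives on \<open>J\<close>, the increment over \<open>[s, t]\<close> is attached to \<open>[s, t] \<inter> J\<close>, which is \<open>[s, t]\<close>
  itself whenever \<open>t \<in> J\<close>.\<close>

definition generalized_brownian_motion ::
  "real measure \<Rightarrow> real set \<Rightarrow> (real set \<Rightarrow> (real \<Rightarrow> real) \<Rightarrow> real)
    \<Rightarrow> (real \<Rightarrow> (real \<Rightarrow> real) measure) \<Rightarrow> bool" where
  "generalized_brownian_motion \<mu> J W P \<longleftrightarrow>
     (let \<A> = {A \<in> sets borel. A \<subseteq> J \<and> emeasure \<mu> A < \<infinity>} in
      \<forall>x. prob_space (P x) \<and> sets (P x) = sets path_space \<and>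
          gaussian_process (P x) \<A> W \<and>
          (\<forall>A\<in>\<A>. prob_space.expectation (P x) (W A) = 0) \<and>
          (\<forall>A\<in>\<A>. \<forall>B\<in>\<A>.
             prob_space.expectation (P x) (\<lambda>\<omega>. W A \<omega> * W B \<omega>) = measure \<mu> (A \<inter> B)) \<and>
          (\<forall>s t. 0 \<le> s \<and> s \<le> t \<longrightarrow> (AE \<omega> in P x. W ({s..t} \<inter> J) \<omega> = \<omega> t - \<omega> s)) \<and>
          (AE \<omega> in P x. \<omega> 0 = x))"

text \<open>\<open>(S\<^sub>t \<phi>)(x) = E\<^sub>x (\<phi> (W\<^sub>t))\<close>\<close>

definition transition_op ::
  "(real \<Rightarrow> (real \<Rightarrow> real) measure) \<Rightarrow> real \<Rightarrow> (real \<Rightarrow> real) \<Rightarrow> real \<Rightarrow> real" where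
  "transition_op P t \<phi> x = prob_space.expectation (P x) (\<lambda>\<omega>. \<phi> (\<omega> t))"


section \<open>The derivative with respect to a measure\<close>

definition bounded_variation_on_interval :: "(real \<Rightarrow> real) \<Rightarrow> real \<Rightarrow> real \<Rightarrow> bool" where
  "bounded_variation_on_interval f a b \<longleftrightarrow>
     (\<exists>V. \<forall>n::nat. \<forall>p. mono_on {..n} p \<and> p ` {..n} \<subseteq> {a..b} \<longrightarrow>
        (\<Sum>i<n. \<bar>f (p (Suc i)) - f (p i)\<bar>) \<le> V)"

definition locally_bounded_variation_on :: "(real \<Rightarrow> real) \<Rightarrow> real set \<Rightarrow> bool" where
  "locally_bounded_variation_on f I \<longleftrightarrow>
     (\<forall>a b. a \<le> b \<and> {a..b} \<subseteq> I \<longrightarrow> bounded_variation_on_interval f a b)"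

text \<open>\<open>\<nabla>f = g\<close> on the interval \<open>I\<close>, where \<open>\<nabla>f = df/d\<mu>\<close> is the Radon--Nikodym derivative
  of the Stieltjes measure of \<open>f\<close>. It is determined up to \<open>\<mu>\<close>-null sets, hence it is
  rendered as a relation between \<open>f\<close> and \<open>g\<close>. The integrability clause is essential, because
  the Bochner integral of a non-integrable function is \<open>0\<close>.\<close>

definition has_nabla :: "real measure \<Rightarrow> real set \<Rightarrow> (real \<Rightarrow> real) \<Rightarrow> (real \<Rightarrow> real) \<Rightarrow> bool" where
  "has_nabla \<mu> I f g \<longleftrightarrow>
     locally_bounded_variation_on f I \<and>
     (\<forall>a b. a \<le> b \<and> {a..b} \<subseteq> I \<longrightarrow>
        set_integrable \<mu> {a..b} g \<and> f b - f a = (LINT t:{a..b}|\<mu>. g t))"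

end

theory Submission
  imports Defs "HOL-Real_Asymp.Real_Asymp"
begin

text \<open>Write \<open>V t = \<mu> [0, t]\<close>. Under \<open>P x\<close> the path at time \<open>t\<close> is Gaussian with mean \<open>x\<close> and variance \<open>V t\<close>
  (\<open>generalized_brownian_motion_expectation\<close>), so \<open>u t x = heat_flow \<phi> (V t) x\<close>, where \<open>heat_flow\<close> is the
  classical heat flow with the variance \<open>v\<close> as its time. For this flow \<open>\<partial>\<^sub>v = 1/2 \<partial>\<^sub>x\<^sub>x\<close>, and the
  statement is that equation after the change of clock \<open>v = V t\<close>, under which \<open>d\<mu>\<close> becomes \<open>dv\<close>.

  The heat equation comes from differentiating under the integral. The initial function \<open>\<phi>\<close> is
  restricted only by integrability against the Gaussian laws that occur, for all centres \<open>x\<close>. This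
  controls \<open>\<phi>\<close> against the Gaussian of the largest variance times any exponential
  (\<open>heat_dominator_integrable\<close>), which dominates all smaller variances and all
  derivatives (\<open>heat_kernel_dominated\<close>).

  In the clock \<open>v\<close> one has to integrate \<open>\<partial>\<^sub>v\<close> of the flow down to \<open>v = 0\<close>, where the flow is merely
  continuous (\<open>heat_flow_tendsto_initial\<close>) and the derivative may fail to be Lebesgue integrable. The
  gauge integral gives the fundamental theorem of calculus there (\<open>heat_flow_has_integral\<close>),
  and the assumed bounded variation turns the gauge integral into a Lebesgue integral
  (\<open>absolutely_integrable_if_bounded_variation\<close>).

  As \<open>\<mu>\<close> has no atoms, \<open>V\<close> is continuous and carries \<open>\<mu>\<close> on \<open>[a, b]\<close> to Lebesgue measure on
  \<open>[V a, V b]\<close> (\<open>distr_shifted_cdf\<close>), which transports the identity back to \<open>\<mu>\<close>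
  (\<open>heat_flow_nabla\<close>).\<close>

section \<open>Differentiation under the integral sign\<close>

text \<open>By the mean value theorem the derivative bound also bounds the difference quotients, so dominated
  convergence applies to them. The derivative is taken within a convex set because a one-sided
  derivative is needed at the largest admissible variance.\<close>

lemma has_field_derivative_lebesgue_integral:
  fixes f f' :: "real \<Rightarrow> 'a \<Rightarrow> real"
  assumes S: "convex S" "s \<in> S"
    and int: "\<And>t. t \<in> S \<Longrightarrow> integrable M (f t)"
    and der: "\<And>t y. t \<in> S \<Longrightarrow> ((\<lambda>t. f t y) has_field_derivative f' t y) (at t within S)"
    and bound: "\<And>t y. t \<in> S \<Longrightarrow> \<bar>f' t y\<bar> \<le> B y"
    and B: "integrable M B"
    and meas: "f' s \<in> borel_measurable M"
  shows "((\<lambda>t. \<integral>y. f t y \<partial>M) has_field_derivative (\<integral>y. f' s y \<partial>M)) (at s within S)"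
  unfolding has_field_derivative_iff tendsto_at_iff_sequentially
proof (intro allI impI)
  fix X :: "nat \<Rightarrow> real"
  assume X: "\<forall>i. X i \<in> S - {s}" and lim: "X \<longlonglongrightarrow> s"
  have XS: "X i \<in> S" "X i \<noteq> s" for i
    using X by auto
  have "(\<lambda>i. \<integral>y. (f (X i) y - f s y) / (X i - s) \<partial>M) \<longlonglongrightarrow> (\<integral>y. f' s y \<partial>M)"
  proof (rule integral_dominated_convergence[where w = B])
    show "(\<lambda>y. (f (X i) y - f s y) / (X i - s)) \<in> borel_measurable M" for i
      using int[OF XS(1)] int[OF S(2)] by measurable
    show "AE y in M. (\<lambda>i. (f (X i) y - f s y) / (X i - s)) \<longlonglongrightarrow> f' s y"
    proof (rule AE_I2)
      fix y
      show "(\<lambda>i. (f (X i) y - f s y) / (X i - s)) \<longlonglongrightarrow> f' s y"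
        using der[OF S(2), of y] X lim
        unfolding has_field_derivative_iff tendsto_at_iff_sequentially comp_def by blast
    qed
    show "AE y in M. norm ((f (X i) y - f s y) / (X i - s)) \<le> B y" for i
    proof (rule AE_I2)
      fix y
      have "norm (f (X i) y - f s y) \<le> B y * norm (X i - s)"
        using bound by (intro field_differentiable_bound[OF S(1) der]) (auto intro: XS S)
      then show "norm ((f (X i) y - f s y) / (X i - s)) \<le> B y"
        using XS(2)[of i] by (simp add: abs_divide divide_le_eq)
    qed
  qed (use B meas in auto)
  moreover have "(\<integral>y. (f (X i) y - f s y) / (X i - s) \<partial>M)
      = ((\<integral>y. f (X i) y \<partial>M) - (\<integral>y. f s y \<partial>M)) / (X i - s)" for i
    using Bochner_Integration.integral_diff[OF int[OF XS(1)] int[OF S(2)]] by simp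
  ultimately show "((\<lambda>t. ((\<integral>y. f t y \<partial>M) - (\<integral>y. f s y \<partial>M)) / (t - s)) \<circ> X)
      \<longlonglongrightarrow> (\<integral>y. f' s y \<partial>M)"
    by (simp only: comp_def)
qed

section \<open>The heat kernel and its derivatives\<close>

text \<open>The second argument is the displacement, and the first is the variance and not the standard
  deviation: the variance is the clock in which the heat equation runs.\<close>

definition heat_kernel :: "real \<Rightarrow> real \<Rightarrow> real" where
  "heat_kernel v z = exp (- z\<^sup>2 / (2 * v)) / sqrt (2 * pi * v)"

lemma normal_density_eq_heat_kernel:
  "0 < v \<Longrightarrow> normal_density x (sqrt v) y = heat_kernel v (y - x)"
  by (simp add: normal_density_def heat_kernel_def)

lemma heat_kernel_nonneg [simp]: "0 \<le> v \<Longrightarrow> 0 \<le> heat_kernel v z"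
  by (simp add: heat_kernel_def)

lemma heat_kernel_measurable [measurable (raw)]:
  assumes [measurable]: "f \<in> borel_measurable M" "g \<in> borel_measurable M"
  shows "(\<lambda>x. heat_kernel (f x) (g x)) \<in> borel_measurable M"
  unfolding heat_kernel_def by measurable

lemma heat_kernel_integral:
  assumes "0 < v"
  shows "integrable lborel (\<lambda>y. heat_kernel v (y - x))"
    and "(\<integral>y. heat_kernel v (y - x) \<partial>lborel) = 1"
proof -
  have "normal_density x (sqrt v) = (\<lambda>y. heat_kernel v (y - x))"
    using assms by (simp add: fun_eq_iff normal_density_eq_heat_kernel)
  then show "integrable lborel (\<lambda>y. heat_kernel v (y - x))"
    and "(\<integral>y. heat_kernel v (y - x) \<partial>lborel) = 1"
    using integrable_normal_density[of "sqrt v" x] integral_normal_density[of "sqrt v" x] assms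
    by simp_all
qed

definition heat_kernel_dx :: "real \<Rightarrow> real \<Rightarrow> real" where
  "heat_kernel_dx v z = z / v * heat_kernel v z"

definition heat_kernel_dxx :: "real \<Rightarrow> real \<Rightarrow> real" where
  "heat_kernel_dxx v z = (z\<^sup>2 / v\<^sup>2 - 1 / v) * heat_kernel v z"

lemma heat_kernel_has_derivative_x:
  "0 < v \<Longrightarrow> ((\<lambda>x. heat_kernel v (y - x)) has_field_derivative heat_kernel_dx v (y - x)) (at x within S)"
proof -
  assume "0 < v"
  then have "((\<lambda>x. exp (- (y - x)\<^sup>2 / (2 * v))) has_field_derivative
      (y - x) / v * exp (- (y - x)\<^sup>2 / (2 * v))) (at x within S)"
    by (auto intro!: derivative_eq_intros simp: power2_eq_square field_simps)
  from DERIV_cdivide[OF this, of "sqrt (2 * pi * v)"] show ?thesis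
    by (simp add: heat_kernel_def heat_kernel_dx_def)
qed

lemma heat_kernel_dx_has_derivative_x:
  "0 < v \<Longrightarrow>
   ((\<lambda>x. heat_kernel_dx v (y - x)) has_field_derivative heat_kernel_dxx v (y - x)) (at x within S)"
  unfolding heat_kernel_dx_def heat_kernel_dxx_def
  by (rule derivative_eq_intros heat_kernel_has_derivative_x refl
      | simp add: heat_kernel_dx_def power2_eq_square field_simps)+

text \<open>The heat equation for the kernel itself.\<close>

lemma heat_kernel_has_derivative_v:
  assumes "0 < v"
  shows "((\<lambda>v. heat_kernel v z) has_field_derivative heat_kernel_dxx v z / 2) (at v within S)"
proof -
  have "((\<lambda>v. exp (- z\<^sup>2 / (2 * v)) / sqrt (2 * pi * v)) has_field_derivative
      ((exp (- z\<^sup>2 / (2 * v)) * (z\<^sup>2 / (2 * v\<^sup>2))) * sqrt (2 * pi * v)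
        - exp (- z\<^sup>2 / (2 * v)) * (inverse (sqrt (2 * pi * v)) / 2 * (2 * pi)))
       / (sqrt (2 * pi * v) * sqrt (2 * pi * v))) (at v within S)"
    using assms
    by (auto intro!: derivative_eq_intros simp: power2_eq_square mult_less_0_iff)
  moreover have "((exp (- z\<^sup>2 / (2 * v)) * (z\<^sup>2 / (2 * v\<^sup>2))) * sqrt (2 * pi * v)
        - exp (- z\<^sup>2 / (2 * v)) * (inverse (sqrt (2 * pi * v)) / 2 * (2 * pi)))
       / (sqrt (2 * pi * v) * sqrt (2 * pi * v)) = heat_kernel_dxx v z / 2" (is "?l = ?r")
  proof -
    define q where "q = sqrt (2 * pi * v)"
    have q: "q > 0" "2 * pi * v = q * q"
      using assms by (auto simp: q_def)
    then have p: "2 * pi = q * q / v"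
      using assms by (simp add: field_simps)
    show ?thesis
      unfolding heat_kernel_dxx_def heat_kernel_def q_def[symmetric] p
      using q(1) assms by (simp add: field_simps power2_eq_square)
  qed
  ultimately show ?thesis
    by (simp only: heat_kernel_def)
qed

text \<open>One weight dominates the kernel, and with it the polynomial factors that differentiation produces,
  for all variances in \<open>[\<epsilon>, V]\<close> and all centres in \<open>[-R, R]\<close>. It is a Gaussian of the largest variance
  \<open>V\<close> times an exponential of \<open>\<bar>y\<bar>\<close>: moving the centre costs a factor \<open>exp (R \<bar>y\<bar> / V)\<close>, and the
  polynomial is absorbed by \<open>exp \<bar>y\<bar>\<close>. No Gaussian of a larger variance than \<open>V\<close> enters, so
  integrability of the initial function at the variance \<open>V\<close> alone is enough.\<close>

lemma heat_kernel_dominated: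
  assumes "0 < \<epsilon>" "\<epsilon> \<le> v" "v \<le> V" "\<bar>x\<bar> \<le> R"
  shows "(1 + (y - x)\<^sup>2) * heat_kernel v (y - x)
     \<le> 2 * exp R / sqrt (2 * pi * \<epsilon>) * (exp (- y\<^sup>2 / (2 * V)) * exp ((1 + R / V) * \<bar>y\<bar>))"
proof -
  have v: "0 < v" "0 < V" "0 \<le> R"
    using assms by auto
  have "1 + (\<bar>y\<bar> + R)\<^sup>2 \<le> 2 * exp (\<bar>y\<bar> + R)"
    using exp_lower_Taylor_quadratic[of "\<bar>y\<bar> + R"] v by simp
  moreover have "(y - x)\<^sup>2 \<le> (\<bar>y\<bar> + R)\<^sup>2"
    using assms by (intro abs_le_square_iff[THEN iffD1]) simp
  ultimately have poly: "1 + (y - x)\<^sup>2 \<le> 2 * exp R * exp \<bar>y\<bar>"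
    by (simp add: exp_add mult.commute mult.left_commute)
  have "x * y \<le> \<bar>x\<bar> * \<bar>y\<bar>"
    by (metis abs_ge_self abs_mult)
  also have "\<dots> \<le> R * \<bar>y\<bar>"
    using assms by (intro mult_right_mono) auto
  finally have "2 * y * x \<le> 2 * R * \<bar>y\<bar>"
    by (simp add: mult.commute)
  then have "y\<^sup>2 - 2 * R * \<bar>y\<bar> \<le> (y - x)\<^sup>2"
    using zero_le_power2[of x] unfolding power2_diff by linarith
  then have "(y\<^sup>2 - 2 * R * \<bar>y\<bar>) / (2 * V) \<le> (y - x)\<^sup>2 / (2 * V)"
    using v by (intro divide_right_mono) auto
  also have "\<dots> \<le> (y - x)\<^sup>2 / (2 * v)"
    using v assms by (intro divide_left_mono) auto
  finally have "exp (- (y - x)\<^sup>2 / (2 * v)) \<le> exp (- y\<^sup>2 / (2 * V) + R / V * \<bar>y\<bar>)"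
    using v by (simp add: field_simps)
  then have gauss: "exp (- (y - x)\<^sup>2 / (2 * v)) \<le> exp (- y\<^sup>2 / (2 * V)) * exp (R / V * \<bar>y\<bar>)"
    by (simp only: exp_add)
  have "heat_kernel v (y - x)
      \<le> exp (- y\<^sup>2 / (2 * V)) * exp (R / V * \<bar>y\<bar>) / sqrt (2 * pi * \<epsilon>)"
    unfolding heat_kernel_def using assms gauss by (intro frac_le) auto
  then have "(1 + (y - x)\<^sup>2) * heat_kernel v (y - x) \<le>
     (2 * exp R * exp \<bar>y\<bar>) * (exp (- y\<^sup>2 / (2 * V)) * exp (R / V * \<bar>y\<bar>) / sqrt (2 * pi * \<epsilon>))"
    using poly v by (intro mult_mono) auto
  also have "\<dots> = 2 * exp R / sqrt (2 * pi * \<epsilon>) *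
      (exp (- y\<^sup>2 / (2 * V)) * exp ((1 + R / V) * \<bar>y\<bar>))"
    by (simp add: exp_add distrib_right)
  finally show ?thesis .
qed

text \<open>Each derivative is the kernel times a polynomial in \<open>z\<close> of degree at most \<open>2\<close>.\<close>

lemma heat_kernel_derivatives_le:
  assumes "0 < \<epsilon>" "\<epsilon> \<le> v" and k: "k \<in> {heat_kernel, heat_kernel_dx, heat_kernel_dxx}"
  shows "\<bar>k v z\<bar> \<le> (1 + 1 / \<epsilon> + 1 / \<epsilon>\<^sup>2) * ((1 + z\<^sup>2) * heat_kernel v z)"
proof -
  have v: "0 < v" "1 / v \<le> 1 / \<epsilon>" "1 / v\<^sup>2 \<le> 1 / \<epsilon>\<^sup>2" "0 < 1 / \<epsilon>" "0 < 1 / \<epsilon>\<^sup>2"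
    using assms by (auto intro!: divide_left_mono power_mono)
  have z: "\<bar>z\<bar> \<le> 1 + z\<^sup>2"
    using abs_square_le_1[of z] sum_squares_bound[of 1 "\<bar>z\<bar>"] by simp
  define p where "p = (1 + 1 / \<epsilon> + 1 / \<epsilon>\<^sup>2) * (1 + z\<^sup>2)"
  have "0 \<le> 1 / \<epsilon> * z\<^sup>2" "0 \<le> 1 / \<epsilon>\<^sup>2 * z\<^sup>2"
    using v by simp_all
  then have p: "1 \<le> p" "1 / \<epsilon> * (1 + z\<^sup>2) \<le> p" "1 / \<epsilon>\<^sup>2 * z\<^sup>2 + 1 / \<epsilon> \<le> p"
    using v unfolding p_def by (simp_all add: distrib_left distrib_right)
  have "\<bar>z / v\<bar> = 1 / v * \<bar>z\<bar>"
    using v by (simp add: abs_divide)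
  also have "\<dots> \<le> 1 / \<epsilon> * (1 + z\<^sup>2)"
    using v z by (intro mult_mono) auto
  finally have dx: "\<bar>z / v\<bar> \<le> p"
    using p by linarith
  have "z\<^sup>2 / v\<^sup>2 = 1 / v\<^sup>2 * z\<^sup>2"
    by simp
  also have "\<dots> \<le> 1 / \<epsilon>\<^sup>2 * z\<^sup>2"
    using v by (intro mult_right_mono) auto
  finally have "z\<^sup>2 / v\<^sup>2 \<le> 1 / \<epsilon>\<^sup>2 * z\<^sup>2" .
  moreover have "0 \<le> z\<^sup>2 / v\<^sup>2" "0 < 1 / v"
    using v by auto
  ultimately have dxx: "\<bar>z\<^sup>2 / v\<^sup>2 - 1 / v\<bar> \<le> p"
    using p v by linarith
  have "\<exists>q. k v z = q * heat_kernel v z \<and> \<bar>q\<bar> \<le> p"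
  proof -
    consider "k = heat_kernel" | "k = heat_kernel_dx" | "k = heat_kernel_dxx"
      using k by auto
    then show ?thesis
    proof cases
      case 1
      then show ?thesis using p(1) by (intro exI[of _ 1]) simp
    next
      case 2
      then show ?thesis using dx by (intro exI[of _ "z / v"]) (simp add: heat_kernel_dx_def)
    next
      case 3
      then show ?thesis
        using dxx by (intro exI[of _ "z\<^sup>2 / v\<^sup>2 - 1 / v"]) (simp add: heat_kernel_dxx_def)
    qed
  qed
  then obtain q where "k v z = q * heat_kernel v z" "\<bar>q\<bar> \<le> p"
    by auto
  then show ?thesis
    using v mult_right_mono[of "\<bar>q\<bar>" p "heat_kernel v z"]
    by (simp add: abs_mult p_def mult.assoc)
qed

section \<open>Heat flow of an unbounded initial function\<close>

text \<open>Integrability is asked for every centre \<open>x\<close>. Completing the square turns a shift of the centre into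
  an exponential factor, so this is integrability of \<open>\<phi>\<close> against \<open>exp (- y\<^sup>2 / (2 * V))\<close> times any
  exponential.\<close>

definition heat_convolvable :: "(real \<Rightarrow> real) \<Rightarrow> real \<Rightarrow> bool" where
  "heat_convolvable \<phi> V \<longleftrightarrow>
     0 < V \<and> \<phi> \<in> borel_measurable borel \<and>
     (\<forall>x. integrable lborel (\<lambda>y. \<phi> y * heat_kernel V (y - x)))"

definition heat_dominator :: "(real \<Rightarrow> real) \<Rightarrow> real \<Rightarrow> real \<Rightarrow> real \<Rightarrow> real" where
  "heat_dominator \<phi> V c y = \<bar>\<phi> y\<bar> * (exp (- y\<^sup>2 / (2 * V)) * exp (c * \<bar>y\<bar>))"

lemma heat_dominator_integrable:
  assumes "heat_convolvable \<phi> V"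
  shows "integrable lborel (heat_dominator \<phi> V c)"
proof -
  have V: "0 < V" and [measurable]: "\<phi> \<in> borel_measurable borel"
    and int: "integrable lborel (\<lambda>y. \<phi> y * heat_kernel V (y - x))" for x
    using assms by (auto simp: heat_convolvable_def)
  \<comment> \<open>\<open>C\<close> is the constant left over when the square in the exponent is completed.\<close>
  define C where "C = exp (c\<^sup>2 * V / 2) * sqrt (2 * pi * V)"
  have square: "exp (- y\<^sup>2 / (2 * V)) * exp (d * y) = C * heat_kernel V (y - d * V)"
    if "d\<^sup>2 = c\<^sup>2" for d y
  proof -
    have "- y\<^sup>2 / (2 * V) + d * y = c\<^sup>2 * V / 2 + - (y - d * V)\<^sup>2 / (2 * V)"
      unfolding that[symmetric] using V by (simp add: power2_eq_square field_simps)
    then have "exp (- y\<^sup>2 / (2 * V)) * exp (d * y)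
        = exp (c\<^sup>2 * V / 2) * exp (- (y - d * V)\<^sup>2 / (2 * V))"
      by (simp only: exp_add[symmetric])
    then show ?thesis
      using V by (simp add: C_def heat_kernel_def)
  qed
  have "integrable lborel (\<lambda>y. C * (\<bar>\<phi> y * heat_kernel V (y - c * V)\<bar> +
      \<bar>\<phi> y * heat_kernel V (y - (- c) * V)\<bar>))"
    by (intro integrable_mult_right Bochner_Integration.integrable_add integrable_abs int)
  then show ?thesis
  proof (rule Bochner_Integration.integrable_bound)
    show "heat_dominator \<phi> V c \<in> borel_measurable lborel"
      unfolding heat_dominator_def by measurable
    show "AE y in lborel. norm (heat_dominator \<phi> V c y) \<le>
        norm (C * (\<bar>\<phi> y * heat_kernel V (y - c * V)\<bar> + \<bar>\<phi> y * heat_kernel V (y - (- c) * V)\<bar>))"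
    proof (rule AE_I2)
      fix y
      have "exp (c * \<bar>y\<bar>) \<le> exp (c * y) + exp (- c * y)"
        by (cases "0 \<le> y") auto
      then have "heat_dominator \<phi> V c y
          \<le> \<bar>\<phi> y\<bar> * (exp (- y\<^sup>2 / (2 * V)) * (exp (c * y) + exp (- c * y)))"
        unfolding heat_dominator_def by (intro mult_left_mono) auto
      also have "\<dots> = \<bar>\<phi> y\<bar> * (C * (heat_kernel V (y - c * V) + heat_kernel V (y - (- c) * V)))"
        using square[of c y] square[of "- c" y] by (simp add: distrib_left)
      also have "\<dots> = C * (\<bar>\<phi> y * heat_kernel V (y - c * V)\<bar> +
          \<bar>\<phi> y * heat_kernel V (y - (- c) * V)\<bar>)"
        using V by (simp add: abs_mult distrib_left mult.left_commute)
      finally show "norm (heat_dominator \<phi> V c y) \<le>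
        norm (C * (\<bar>\<phi> y * heat_kernel V (y - c * V)\<bar> + \<bar>\<phi> y * heat_kernel V (y - (- c) * V)\<bar>))"
        by (simp add: heat_dominator_def)
    qed
  qed
qed

text \<open>Variance \<open>0\<close> is the point mass at \<open>x\<close>, where the kernel formula would divide by zero.\<close>

definition heat_flow :: "(real \<Rightarrow> real) \<Rightarrow> real \<Rightarrow> real \<Rightarrow> real" where
  "heat_flow \<phi> v x = (if v = 0 then \<phi> x else \<integral>y. \<phi> y * heat_kernel v (y - x) \<partial>lborel)"

definition heat_flow_dxx :: "(real \<Rightarrow> real) \<Rightarrow> real \<Rightarrow> real \<Rightarrow> real" where
  "heat_flow_dxx \<phi> v x = (\<integral>y. \<phi> y * heat_kernel_dxx v (y - x) \<partial>lborel)"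

context
  fixes \<phi> :: "real \<Rightarrow> real" and V :: real
  assumes conv: "heat_convolvable \<phi> V"
begin

lemma initial_measurable: "\<phi> \<in> borel_measurable borel"
  using conv by (simp add: heat_convolvable_def)

text \<open>One integrable function bounds all three kernel products locally uniformly, up to and including the
  variance \<open>V\<close>. This is the domination behind every limit under the integral below.\<close>

lemma kernel_products_dominated:
  assumes "0 < \<epsilon>"
  obtains B where "integrable lborel B"
    and "\<And>k v x y. k \<in> {heat_kernel, heat_kernel_dx, heat_kernel_dxx} \<Longrightarrow> \<epsilon> \<le> v \<Longrightarrow> v \<le> V \<Longrightarrow>
      \<bar>x\<bar> \<le> R \<Longrightarrow> \<bar>\<phi> y * k v (y - x)\<bar> \<le> B y"
proof -
  define K where "K = 1 + 1 / \<epsilon> + 1 / \<epsilon>\<^sup>2"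
  have K: "0 \<le> K"
    using assms by (simp add: K_def)
  define B where "B y = K * (2 * exp R / sqrt (2 * pi * \<epsilon>)) * heat_dominator \<phi> V (1 + R / V) y" for y
  show thesis
  proof (rule that[of B])
    show "integrable lborel B"
      unfolding B_def by (intro integrable_mult_right heat_dominator_integrable conv)
    fix k :: "real \<Rightarrow> real \<Rightarrow> real" and v x y :: real
    assume *: "k \<in> {heat_kernel, heat_kernel_dx, heat_kernel_dxx}" "\<epsilon> \<le> v" "v \<le> V" "\<bar>x\<bar> \<le> R"
    have "\<bar>k v (y - x)\<bar> \<le> K * ((1 + (y - x)\<^sup>2) * heat_kernel v (y - x))"
      unfolding K_def using assms * by (intro heat_kernel_derivatives_le) auto
    also have "\<dots> \<le> K * (2 * exp R / sqrt (2 * pi * \<epsilon>) *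
        (exp (- y\<^sup>2 / (2 * V)) * exp ((1 + R / V) * \<bar>y\<bar>)))"
      using assms * K by (intro mult_left_mono heat_kernel_dominated) auto
    finally have "\<bar>\<phi> y\<bar> * \<bar>k v (y - x)\<bar> \<le> \<bar>\<phi> y\<bar> * (K * (2 * exp R / sqrt (2 * pi * \<epsilon>) *
        (exp (- y\<^sup>2 / (2 * V)) * exp ((1 + R / V) * \<bar>y\<bar>))))"
      by (intro mult_left_mono) auto
    then show "\<bar>\<phi> y * k v (y - x)\<bar> \<le> B y"
      by (simp add: B_def heat_dominator_def abs_mult mult.left_commute mult.assoc)
  qed
qed

lemma kernel_product_measurable:
  assumes "k \<in> {heat_kernel, heat_kernel_dx, heat_kernel_dxx}"
  shows "(\<lambda>y. \<phi> y * k v (y - x)) \<in> borel_measurable lborel"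
proof -
  note [measurable] = initial_measurable
  show ?thesis
    using assms by (auto simp: heat_kernel_dx_def heat_kernel_dxx_def)
qed

lemma kernel_products_integrable:
  assumes k: "k \<in> {heat_kernel, heat_kernel_dx, heat_kernel_dxx}" and v: "0 < v" "v \<le> V"
  shows "integrable lborel (\<lambda>y. \<phi> y * k v (y - x))"
proof -
  obtain B where B: "integrable lborel B"
    "\<And>k v' x' y. k \<in> {heat_kernel, heat_kernel_dx, heat_kernel_dxx} \<Longrightarrow> v \<le> v' \<Longrightarrow> v' \<le> V \<Longrightarrow>
      \<bar>x'\<bar> \<le> \<bar>x\<bar> \<Longrightarrow> \<bar>\<phi> y * k v' (y - x')\<bar> \<le> B y"
    using kernel_products_dominated[OF v(1)] by metis
  show ?thesis
  proof (rule Bochner_Integration.integrable_bound[OF B(1) kernel_product_measurable[OF k]])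
    show "AE y in lborel. norm (\<phi> y * k v (y - x)) \<le> norm (B y)"
      using B(2)[OF k order_refl v(2) order_refl] by (auto intro!: AE_I2 order_trans[OF _ abs_ge_self])
  qed
qed

lemma kernel_product_has_derivative_x:
  assumes v: "0 < v" "v \<le> V"
    and k: "k \<in> {heat_kernel, heat_kernel_dx, heat_kernel_dxx}"
    and k': "k' \<in> {heat_kernel, heat_kernel_dx, heat_kernel_dxx}"
    and der: "\<And>x y S. ((\<lambda>x. k v (y - x)) has_field_derivative k' v (y - x)) (at x within S)"
  shows "((\<lambda>x. \<integral>y. \<phi> y * k v (y - x) \<partial>lborel) has_field_derivative
     (\<integral>y. \<phi> y * k' v (y - x) \<partial>lborel)) (at x)"
proof -
  \<comment> \<open>Differentiability at \<open>x\<close> is local, so an open interval containing \<open>x\<close> is enough.\<close>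
  define R where "R = \<bar>x\<bar> + 1"
  obtain B where B: "integrable lborel B"
    "\<And>k v' x y. k \<in> {heat_kernel, heat_kernel_dx, heat_kernel_dxx} \<Longrightarrow> v \<le> v' \<Longrightarrow> v' \<le> V \<Longrightarrow>
      \<bar>x\<bar> \<le> R \<Longrightarrow> \<bar>\<phi> y * k v' (y - x)\<bar> \<le> B y"
    using kernel_products_dominated[OF v(1)] by metis
  have "((\<lambda>x. \<integral>y. \<phi> y * k v (y - x) \<partial>lborel) has_field_derivative
     (\<integral>y. \<phi> y * k' v (y - x) \<partial>lborel)) (at x within {-R<..<R})"
  proof (rule has_field_derivative_lebesgue_integral[where B = B])
    show "x \<in> {-R<..<R}"
      by (auto simp: R_def)
    show "\<bar>\<phi> y * k' v (y - t)\<bar> \<le> B y" if "t \<in> {-R<..<R}" for t y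
      using that v k' by (intro B(2)) auto
    show "((\<lambda>x. \<phi> y * k v (y - x)) has_field_derivative \<phi> y * k' v (y - t)) (at t within {-R<..<R})"
      for t y by (intro DERIV_cmult der)
    show "(\<lambda>y. \<phi> y * k' v (y - x)) \<in> borel_measurable lborel"
      by (rule kernel_product_measurable[OF k'])
  qed (use B(1) v k in \<open>auto intro: kernel_products_integrable\<close>)
  moreover have "at x within {-R<..<R} = at x"
    by (rule at_within_open) (auto simp: R_def)
  ultimately show ?thesis
    by simp
qed

lemma heat_flow_twice_differentiable:
  assumes v: "0 < v" "v \<le> V"
  shows "heat_flow \<phi> v differentiable (at x)"
    and "deriv (heat_flow \<phi> v) differentiable (at x)"
    and "deriv (deriv (heat_flow \<phi> v)) x = heat_flow_dxx \<phi> v x"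
proof -
  have flow: "heat_flow \<phi> v = (\<lambda>x. \<integral>y. \<phi> y * heat_kernel v (y - x) \<partial>lborel)"
    using v by (simp add: heat_flow_def fun_eq_iff)
  have 1: "(heat_flow \<phi> v has_field_derivative (\<integral>y. \<phi> y * heat_kernel_dx v (y - x) \<partial>lborel)) (at x)"
    for x unfolding flow
    by (rule kernel_product_has_derivative_x) (auto intro: v heat_kernel_has_derivative_x)
  then have dx: "deriv (heat_flow \<phi> v) = (\<lambda>x. \<integral>y. \<phi> y * heat_kernel_dx v (y - x) \<partial>lborel)"
    by (auto simp: fun_eq_iff intro: DERIV_imp_deriv)
  have 2: "(deriv (heat_flow \<phi> v) has_field_derivative heat_flow_dxx \<phi> v x) (at x)"
    unfolding dx heat_flow_dxx_def
    by (rule kernel_product_has_derivative_x) (auto intro: v heat_kernel_dx_has_derivative_x)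
  show "heat_flow \<phi> v differentiable (at x)" "deriv (heat_flow \<phi> v) differentiable (at x)"
    "deriv (deriv (heat_flow \<phi> v)) x = heat_flow_dxx \<phi> v x"
    using 1 2 by (auto intro: DERIV_imp_deriv simp: real_differentiable_def)
qed

lemma heat_flow_dxx_bounded:
  assumes "0 < \<epsilon>"
  obtains L where "\<And>v. \<epsilon> \<le> v \<Longrightarrow> v \<le> V \<Longrightarrow> \<bar>heat_flow_dxx \<phi> v x\<bar> \<le> L"
proof -
  obtain B where B: "integrable lborel B"
    "\<And>k v x' y. k \<in> {heat_kernel, heat_kernel_dx, heat_kernel_dxx} \<Longrightarrow> \<epsilon> \<le> v \<Longrightarrow> v \<le> V \<Longrightarrow>
      \<bar>x'\<bar> \<le> \<bar>x\<bar> \<Longrightarrow> \<bar>\<phi> y * k v (y - x')\<bar> \<le> B y"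
    using kernel_products_dominated[OF assms] by metis
  show thesis
  proof (rule that[of "\<integral>y. B y \<partial>lborel"])
    fix v assume v: "\<epsilon> \<le> v" "v \<le> V"
    have "\<bar>heat_flow_dxx \<phi> v x\<bar> \<le> (\<integral>y. \<bar>\<phi> y * heat_kernel_dxx v (y - x)\<bar> \<partial>lborel)"
      unfolding heat_flow_dxx_def by (rule integral_abs_bound)
    also have "\<dots> \<le> (\<integral>y. B y \<partial>lborel)"
      using v assms B by (intro integral_mono integrable_abs kernel_products_integrable B) auto
    finally show "\<bar>heat_flow_dxx \<phi> v x\<bar> \<le> (\<integral>y. B y \<partial>lborel)" .
  qed
qed

text \<open>The heat equation for the flow; at \<open>v = V\<close> the derivative is one-sided.\<close>

lemma heat_flow_has_derivative_v:
  assumes "0 < \<epsilon>" and v: "\<epsilon> \<le> v" "v \<le> V"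
  shows "((\<lambda>v. heat_flow \<phi> v x) has_field_derivative heat_flow_dxx \<phi> v x / 2) (at v within {\<epsilon>..V})"
proof -
  obtain B where B: "integrable lborel B"
    "\<And>k v x' y. k \<in> {heat_kernel, heat_kernel_dx, heat_kernel_dxx} \<Longrightarrow> \<epsilon> \<le> v \<Longrightarrow> v \<le> V \<Longrightarrow>
      \<bar>x'\<bar> \<le> \<bar>x\<bar> \<Longrightarrow> \<bar>\<phi> y * k v (y - x')\<bar> \<le> B y"
    using kernel_products_dominated[OF assms(1)] by metis
  have "((\<lambda>v. \<integral>y. \<phi> y * heat_kernel v (y - x) \<partial>lborel) has_field_derivative
     (\<integral>y. \<phi> y * (heat_kernel_dxx v (y - x) / 2) \<partial>lborel)) (at v within {\<epsilon>..V})"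
  proof (rule has_field_derivative_lebesgue_integral[where B = B])
    show "\<bar>\<phi> y * (heat_kernel_dxx t (y - x) / 2)\<bar> \<le> B y" if "t \<in> {\<epsilon>..V}" for t y
    proof -
      have "\<bar>\<phi> y * heat_kernel_dxx t (y - x)\<bar> \<le> B y"
        using that by (intro B(2)) auto
      moreover have "\<bar>\<phi> y * (heat_kernel_dxx t (y - x) / 2)\<bar> = \<bar>\<phi> y * heat_kernel_dxx t (y - x)\<bar> / 2"
        by (simp add: abs_mult)
      ultimately show ?thesis
        using abs_ge_zero[of "\<phi> y * heat_kernel_dxx t (y - x)"] by linarith
    qed
    show "((\<lambda>t. \<phi> y * heat_kernel t (y - x)) has_field_derivative
        \<phi> y * (heat_kernel_dxx t (y - x) / 2)) (at t within {\<epsilon>..V})" if "t \<in> {\<epsilon>..V}" for t y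
      using that assms by (intro DERIV_cmult heat_kernel_has_derivative_v) auto
    show "(\<lambda>y. \<phi> y * (heat_kernel_dxx v (y - x) / 2)) \<in> borel_measurable lborel"
      using kernel_product_measurable[of heat_kernel_dxx v x] by simp
  qed (use B(1) assms in \<open>auto intro: kernel_products_integrable\<close>)
  then have "((\<lambda>v. \<integral>y. \<phi> y * heat_kernel v (y - x) \<partial>lborel) has_field_derivative
     heat_flow_dxx \<phi> v x / 2) (at v within {\<epsilon>..V})"
    by (simp add: heat_flow_dxx_def)
  then show ?thesis
    by (rule has_field_derivative_transform_within[OF _ zero_less_one])
      (use assms in \<open>auto simp: heat_flow_def\<close>)
qed

text \<open>Near \<open>x\<close> continuity of \<open>\<phi>\<close> controls the integrand. At distance at least \<open>d\<close> from \<open>x\<close> the kernel of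
  small variance \<open>v\<close> is at most \<open>c v\<close> times the kernel of variance \<open>V\<close>, with \<open>c v\<close> tending to \<open>0\<close>, so
  an unbounded \<open>\<phi>\<close> does no harm there.\<close>

lemma heat_flow_tendsto_initial:
  assumes "isCont \<phi> x"
  shows "((\<lambda>v. heat_flow \<phi> v x) \<longlongrightarrow> \<phi> x) (at_right 0)"
proof -
  have V: "0 < V"
    using conv by (simp add: heat_convolvable_def)
  define D where "D v = (\<integral>y. \<bar>\<phi> y - \<phi> x\<bar> * heat_kernel v (y - x) \<partial>lborel)" for v
  have int: "integrable lborel (\<lambda>y. \<phi> y * heat_kernel v (y - x))" if "0 < v" "v \<le> V" for v
    using that by (intro kernel_products_integrable) auto
  have int_diff: "integrable lborel (\<lambda>y. (\<phi> y - \<phi> x) * heat_kernel v (y - x))"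
    if "0 < v" "v \<le> V" for v
    unfolding left_diff_distrib
    by (intro Bochner_Integration.integrable_diff integrable_mult_right int heat_kernel_integral that)
  have int_abs: "integrable lborel (\<lambda>y. \<bar>\<phi> y - \<phi> x\<bar> * heat_kernel v (y - x))"
    if "0 < v" "v \<le> V" for v
    using integrable_abs[OF int_diff[OF that]] that by (simp add: abs_mult)
  have flow: "\<bar>heat_flow \<phi> v x - \<phi> x\<bar> \<le> D v" if v: "0 < v" "v \<le> V" for v
  proof -
    have "heat_flow \<phi> v x - \<phi> x = (\<integral>y. (\<phi> y - \<phi> x) * heat_kernel v (y - x) \<partial>lborel)"
      unfolding left_diff_distrib using v int[OF v] heat_kernel_integral[OF v(1), of x]
      by (simp add: heat_flow_def)
    also have "\<bar>\<dots>\<bar> \<le> (\<integral>y. \<bar>(\<phi> y - \<phi> x) * heat_kernel v (y - x)\<bar> \<partial>lborel)"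
      by (rule integral_abs_bound)
    finally show ?thesis
      using v by (simp add: D_def abs_mult)
  qed
  have D0: "0 \<le> D V"
    unfolding D_def using V by (intro integral_nonneg_AE) auto
  have "\<exists>r>0. \<forall>v>0. v < r \<longrightarrow> \<bar>heat_flow \<phi> v x - \<phi> x\<bar> < e" if "0 < e" for e
  proof -
    obtain d where d: "0 < d" "\<And>y. \<bar>y - x\<bar> < d \<Longrightarrow> \<bar>\<phi> y - \<phi> x\<bar> < e / 2"
      using assms \<open>0 < e\<close> unfolding continuous_at_eps_delta dist_real_def by (meson half_gt_zero)
    define c where "c v = sqrt (V / v) * exp (d\<^sup>2 / (2 * V) - d\<^sup>2 / (2 * v))" for v
    have "(c \<longlongrightarrow> 0) (at_right 0)"
      unfolding c_def using V d(1) by real_asymp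
    then have "((\<lambda>v. c v * D V) \<longlongrightarrow> 0 * D V) (at_right 0)"
      by (intro tendsto_intros)
    then have "\<forall>\<^sub>F v in at_right 0. c v * D V < e / 2"
      using \<open>0 < e\<close> by (intro order_tendstoD) auto
    then obtain r where r: "0 < r" "\<And>v. 0 < v \<Longrightarrow> v < r \<Longrightarrow> c v * D V < e / 2"
      unfolding eventually_at_right_field by auto
    show ?thesis
    proof (intro exI[of _ "min r V"] conjI allI impI)
      show "0 < min r V"
        using r V by simp
      fix v assume "0 < v" "v < min r V"
      then have v: "0 < v" "v < r" "v \<le> V"
        by auto
      have c0: "0 \<le> c v"
        using v V by (simp add: c_def)
      have far: "heat_kernel v z \<le> c v * heat_kernel V z" if "d \<le> \<bar>z\<bar>" for z
      proof -
        have "d\<^sup>2 \<le> z\<^sup>2"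
          using that d(1) by (intro abs_le_square_iff[THEN iffD1]) simp
        then have "d\<^sup>2 * (1 / (2 * v) - 1 / (2 * V)) \<le> z\<^sup>2 * (1 / (2 * v) - 1 / (2 * V))"
          using v by (intro mult_right_mono) (auto intro!: divide_left_mono)
        then have "- z\<^sup>2 / (2 * v) \<le> (d\<^sup>2 / (2 * V) - d\<^sup>2 / (2 * v)) + - z\<^sup>2 / (2 * V)"
          by (simp add: right_diff_distrib)
        then have "exp (- z\<^sup>2 / (2 * v)) \<le> exp (d\<^sup>2 / (2 * V) - d\<^sup>2 / (2 * v)) * exp (- z\<^sup>2 / (2 * V))"
          by (simp only: exp_add[symmetric] exp_le_cancel_iff)
        then have "heat_kernel v z \<le>
            exp (d\<^sup>2 / (2 * V) - d\<^sup>2 / (2 * v)) * exp (- z\<^sup>2 / (2 * V)) / sqrt (2 * pi * v)"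
          unfolding heat_kernel_def using v by (intro divide_right_mono) auto
        also have "\<dots> = c v * heat_kernel V z"
          using v V by (simp add: c_def heat_kernel_def real_sqrt_divide real_sqrt_mult field_simps)
        finally show ?thesis .
      qed
      have "D v \<le> (\<integral>y. e / 2 * heat_kernel v (y - x)
          + c v * (\<bar>\<phi> y - \<phi> x\<bar> * heat_kernel V (y - x)) \<partial>lborel)"
        unfolding D_def
      proof (rule integral_mono)
        fix y
        show "\<bar>\<phi> y - \<phi> x\<bar> * heat_kernel v (y - x) \<le> e / 2 * heat_kernel v (y - x)
          + c v * (\<bar>\<phi> y - \<phi> x\<bar> * heat_kernel V (y - x))"
        proof (cases "\<bar>y - x\<bar> < d")
          case True
          then have "\<bar>\<phi> y - \<phi> x\<bar> * heat_kernel v (y - x) \<le> e / 2 * heat_kernel v (y - x)"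
            using d(2) v by (intro mult_right_mono) (auto intro: less_imp_le)
          moreover have "0 \<le> c v * (\<bar>\<phi> y - \<phi> x\<bar> * heat_kernel V (y - x))"
            using c0 V by simp
          ultimately show ?thesis
            by linarith
        next
          case False
          then have "\<bar>\<phi> y - \<phi> x\<bar> * heat_kernel v (y - x)
              \<le> \<bar>\<phi> y - \<phi> x\<bar> * (c v * heat_kernel V (y - x))"
            by (intro mult_left_mono far) auto
          moreover have "0 \<le> e / 2 * heat_kernel v (y - x)"
            using v \<open>0 < e\<close> by simp
          ultimately show ?thesis
            by (simp add: mult.left_commute)
        qed
      qed (use v V in \<open>auto intro!: Bochner_Integration.integrable_add int_abs heat_kernel_integral\<close>)
      also have "\<dots> = e / 2 + c v * D V"
        using heat_kernel_integral[OF v(1), of x] int_abs[OF V order_refl] by (simp add: D_def)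
      also have "\<dots> < e"
        using r(2)[OF v(1,2)] by simp
      finally show "\<bar>heat_flow \<phi> v x - \<phi> x\<bar> < e"
        using flow[OF v(1,3)] by simp
    qed
  qed
  then show ?thesis
    unfolding tendsto_iff eventually_at_right_field dist_real_def by auto
qed

text \<open>At a positive \<open>v\<close> the derivative within \<open>[v/2, V]\<close> gives continuity, at \<open>v = 0\<close> the initial limit.\<close>

lemma heat_flow_continuous_on:
  assumes "isCont \<phi> x"
  shows "continuous_on {0..V} (\<lambda>v. heat_flow \<phi> v x)"
  unfolding continuous_on_eq_continuous_within
proof
  fix v assume v: "v \<in> {0..V}"
  show "continuous (at v within {0..V}) (\<lambda>v. heat_flow \<phi> v x)"
  proof (cases "v = 0")
    case True
    have "((\<lambda>v. heat_flow \<phi> v x) \<longlongrightarrow> \<phi> x) (at 0 within {0..V})"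
      using heat_flow_tendsto_initial[OF assms] conv
      by (simp add: at_within_Icc_at_right heat_convolvable_def)
    then show ?thesis
      using True by (simp add: continuous_within heat_flow_def)
  next
    case False
    then have "continuous (at v within {v/2..V}) (\<lambda>v. heat_flow \<phi> v x)"
      using v heat_flow_has_derivative_v[of "v/2" v x]
      by (auto intro: DERIV_continuous)
    \<comment> \<open>The two sets agree near \<open>v\<close>.\<close>
    moreover have "at v within {v/2..V} = at v within {0..V}"
      using False v by (intro at_within_nhd[of v "{v/2<..}"]) auto
    ultimately show ?thesis
      by (simp add: continuous_within)
  qed
qed

end

section \<open>Bounded variation and absolute integrability\<close>

text \<open>The sums of \<open>\<bar>\<integral>\<^sub>K h\<bar>\<close> over the divisions of \<open>[c, d]\<close> have to be bounded. A division is an unordered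
  set of intervals, whereas variation is defined by monotone sequences. The variation function \<open>T\<close>
  mediates: it bounds each increment of \<open>F\<close> by its own increment, and its increments are
  additive over a division, so nothing has to be sorted.\<close>

lemma absolutely_integrable_if_bounded_variation:
  fixes F h :: "real \<Rightarrow> real"
  assumes "c \<le> d"
    and h: "\<And>x y. c \<le> x \<Longrightarrow> x \<le> y \<Longrightarrow> y \<le> d \<Longrightarrow> (h has_integral (F y - F x)) {x..y}"
    and bv: "bounded_variation_on_interval F c d"
  shows "h absolutely_integrable_on {c..d}"
proof -
  obtain K where K: "\<And>n p. mono_on {..n::nat} p \<Longrightarrow> p ` {..n} \<subseteq> {c..d} \<Longrightarrow>
      (\<Sum>i<n. \<bar>F (p (Suc i)) - F (p i)\<bar>) \<le> K"
    using bv unfolding bounded_variation_on_interval_def by metis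
  define P where "P v = {(n::nat, p). mono_on {..n} p \<and> p ` {..n} \<subseteq> {c..v}}" for v
  define var where "var q = (\<Sum>i<fst q. \<bar>F (snd q (Suc i)) - F (snd q i)\<bar>)" for q :: "nat \<times> (nat \<Rightarrow> real)"
  define T where "T v = (SUP q\<in>P v. var q)" for v
  have bdd: "bdd_above (var ` P v)" if "v \<le> d" for v
  proof (rule bdd_aboveI2)
    fix q assume "q \<in> P v"
    then show "var q \<le> K"
      using that K[of "fst q" "snd q"] by (fastforce simp: P_def var_def)
  qed
  have P_ne: "P v \<noteq> {}" if "c \<le> v" for v
  proof -
    have "(0, \<lambda>_. c) \<in> P v"
      using that by (auto simp: P_def mono_on_def)
    then show ?thesis by blast
  qed
  have T: "\<bar>F w - F v\<bar> \<le> T w - T v" if "c \<le> v" "v \<le> w" "w \<le> d" for v w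
  proof -
    have "T v \<le> T w - \<bar>F w - F v\<bar>"
      unfolding T_def[of v]
    proof (rule cSUP_least[OF P_ne[OF \<open>c \<le> v\<close>]])
      fix q assume q: "q \<in> P v"
      obtain n p where np: "q = (n, p)"
        by (cases q)
      \<comment> \<open>Appending \<open>v\<close> and \<open>w\<close> to a partition of \<open>[c, v]\<close> adds at least \<open>\<bar>F w - F v\<bar>\<close> to its variation.\<close>
      define p' where "p' i = (if i \<le> n then p i else if i = Suc n then v else w)" for i
      have mono: "mono_on {..n} p" and range: "\<And>i. i \<le> n \<Longrightarrow> c \<le> p i \<and> p i \<le> v"
        using q np by (auto simp: P_def)
      have "(Suc (Suc n), p') \<in> P w"
        unfolding P_def
      proof (safe intro!: monotone_onI)
        fix i j :: nat assume "i \<le> j"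
        then show "p' i \<le> p' j"
          using range[of i] range[of j] mono that by (auto simp: p'_def mono_on_def)
      next
        fix i show "p' i \<in> {c..w}"
          using range[of i] that by (auto simp: p'_def)
      qed
      then have "var (Suc (Suc n), p') \<le> T w"
        unfolding T_def using bdd that by (intro cSUP_upper) auto
      moreover have "var (Suc (Suc n), p') = var q + \<bar>F v - F (p n)\<bar> + \<bar>F w - F v\<bar>"
        by (simp add: var_def np p'_def)
      ultimately show "var q \<le> T w - \<bar>F w - F v\<bar>"
        using abs_ge_zero[of "F v - F (p n)"] by linarith
    qed
    then show ?thesis by linarith
  qed
  have "h absolutely_integrable_on cbox c d"
  proof (rule bounded_variation_absolutely_integrable_interval)
    show "h integrable_on cbox c d"
      using h[of c d] \<open>c \<le> d\<close> by auto
    fix D assume D: "D division_of cbox c d"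
    have interval: "\<exists>x y. K = {x..y} \<and> x \<le> y \<and> c \<le> x \<and> y \<le> d" if "K \<in> D" for K
      using division_ofD(2,3,4)[OF D that]
      by (metis atLeastatMost_subset_iff box_real(2) atLeastatMost_empty_iff2)
    have tag: "(\<lambda>K. (Inf K, K)) ` D tagged_division_of {c..d}"
    proof (rule tagged_division_ofI)
      show "finite ((\<lambda>K. (Inf K, K)) ` D)"
        using division_of_finite[OF D] by simp
      fix x K assume "(x, K) \<in> (\<lambda>K. (Inf K, K)) ` D"
      then have "x = Inf K" "K \<in> D" by auto
      with interval[of K] show "x \<in> K" "K \<subseteq> {c..d}" "\<exists>a b. K = cbox a b"
        by auto
      fix x' K' assume "(x', K') \<in> (\<lambda>K. (Inf K, K)) ` D" "(x, K) \<noteq> (x', K')"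
      then show "interior K \<inter> interior K' = {}"
        using division_ofD(5)[OF D] \<open>x = Inf K\<close> \<open>K \<in> D\<close> by auto
    next
      show "\<Union>{K. \<exists>x. (x, K) \<in> (\<lambda>K. (Inf K, K)) ` D} = {c..d}"
      proof -
        have "{K. \<exists>x. (x, K) \<in> (\<lambda>K. (Inf K, K)) ` D} = D"
          by auto
        then show ?thesis
          using division_ofD(6)[OF D] by simp
      qed
    qed
    have "(\<Sum>K\<in>D. norm (integral K h)) \<le> (\<Sum>K\<in>D. T (Sup K) - T (Inf K))"
    proof (rule sum_mono)
      fix K assume "K \<in> D"
      then obtain x y where xy: "K = {x..y}" "x \<le> y" "c \<le> x" "y \<le> d"
        using interval by blast
      then have "integral K h = F y - F x"
        using h by (auto intro: integral_unique)
      then show "norm (integral K h) \<le> T (Sup K) - T (Inf K)"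
        using T[of x y] xy by simp
    qed
    also have "\<dots> = (\<Sum>(x, K)\<in>(\<lambda>K. (Inf K, K)) ` D. T (Sup K) - T (Inf K))"
      by (subst sum.reindex) (auto simp: inj_on_def)
    also have "\<dots> = T d - T c"
      by (rule additive_tagged_division_1[OF \<open>c \<le> d\<close> tag])
    finally show "(\<Sum>K\<in>D. norm (integral K h)) \<le> T d - T c" .
  qed
  then show ?thesis by simp
qed
lemma bounded_variation_on_interval_cong:
  assumes bv: "bounded_variation_on_interval f a b"
    and eq: "\<And>t. a \<le> t \<Longrightarrow> t \<le> b \<Longrightarrow> f t = g t"
  shows "bounded_variation_on_interval g a b"
proof -
  obtain K where K: "\<And>n p. mono_on {..n::nat} p \<Longrightarrow> p ` {..n} \<subseteq> {a..b} \<Longrightarrow>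
      (\<Sum>i<n. \<bar>f (p (Suc i)) - f (p i)\<bar>) \<le> K"
    using bv unfolding bounded_variation_on_interval_def by metis
  have "(\<Sum>i<n. \<bar>g (p (Suc i)) - g (p i)\<bar>) \<le> K"
    if p: "mono_on {..n} p" "p ` {..n} \<subseteq> {a..b}" for n and p :: "nat \<Rightarrow> real"
  proof -
    have "(\<Sum>i<n. \<bar>g (p (Suc i)) - g (p i)\<bar>) = (\<Sum>i<n. \<bar>f (p (Suc i)) - f (p i)\<bar>)"
      using p(2) eq by (intro sum.cong) (auto simp: image_subset_iff)
    then show ?thesis
      using K[OF p] by simp
  qed
  then show ?thesis
    unfolding bounded_variation_on_interval_def by blast
qed

text \<open>By the intermediate value theorem \<open>V\<close> has a section \<open>\<tau>\<close>, which is monotone although \<open>V\<close> may have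
  flat pieces. It carries partitions of the range back to partitions of \<open>[a, b]\<close>.\<close>

lemma bounded_variation_time_change:
  fixes F V :: "real \<Rightarrow> real"
  assumes "a \<le> b" and V: "continuous_on {a..b} V" "mono_on {a..b} V"
    and bv: "bounded_variation_on_interval (\<lambda>t. F (V t)) a b"
  shows "bounded_variation_on_interval F (V a) (V b)"
proof -
  have "\<exists>t\<in>{a..b}. V t = v" if "v \<in> {V a..V b}" for v
    using IVT'[of V a v b] that V(1) \<open>a \<le> b\<close> by auto
  then obtain \<tau> where \<tau>: "\<And>v. v \<in> {V a..V b} \<Longrightarrow> \<tau> v \<in> {a..b} \<and> V (\<tau> v) = v"
    by metis
  have mono: "\<tau> v \<le> \<tau> w" if "v \<in> {V a..V b}" "w \<in> {V a..V b}" "v \<le> w" for v w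
  proof (rule ccontr)
    assume "\<not> \<tau> v \<le> \<tau> w"
    then have "V (\<tau> w) \<le> V (\<tau> v)"
      using \<tau> that by (intro mono_onD[OF V(2)]) auto
    then have "v = w"
      using \<tau> that by auto
    with \<open>\<not> \<tau> v \<le> \<tau> w\<close> show False by simp
  qed
  obtain K where K: "\<And>n p. mono_on {..n::nat} p \<Longrightarrow> p ` {..n} \<subseteq> {a..b} \<Longrightarrow>
      (\<Sum>i<n. \<bar>F (V (p (Suc i))) - F (V (p i))\<bar>) \<le> K"
    using bv unfolding bounded_variation_on_interval_def by metis
  show ?thesis
    unfolding bounded_variation_on_interval_def
  proof (intro exI[of _ K] allI impI)
    fix n p assume p: "mono_on {..n::nat} p \<and> p ` {..n} \<subseteq> {V a..V b}"
    have "(\<Sum>i<n. \<bar>F (p (Suc i)) - F (p i)\<bar>)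
        = (\<Sum>i<n. \<bar>F (V (\<tau> (p (Suc i)))) - F (V (\<tau> (p i)))\<bar>)"
      using p \<tau> by (intro sum.cong) (auto simp: image_subset_iff)
    also have "\<dots> \<le> K"
    proof (rule K)
      show "mono_on {..n} (\<lambda>i. \<tau> (p i))"
        using p by (intro mono_onI mono) (auto simp: image_subset_iff intro: mono_onD)
      show "(\<lambda>i. \<tau> (p i)) ` {..n} \<subseteq> {a..b}"
        using p \<tau> by auto
    qed
    finally show "(\<Sum>i<n. \<bar>F (p (Suc i)) - F (p i)\<bar>) \<le> K" .
  qed
qed

lemma bounded_variation_if_lipschitz_time_change:
  fixes F V :: "real \<Rightarrow> real"
  assumes lip: "\<And>s t. a \<le> s \<Longrightarrow> s \<le> t \<Longrightarrow> t \<le> b \<Longrightarrow> \<bar>F t - F s\<bar> \<le> L * (V t - V s)"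
    and V: "mono_on {a..b} V" and "0 \<le> L"
  shows "bounded_variation_on_interval F a b"
  unfolding bounded_variation_on_interval_def
proof (intro exI[of _ "L * (V b - V a)"] allI impI)
  fix n p assume p: "mono_on {..n::nat} p \<and> p ` {..n} \<subseteq> {a..b}"
  then have range: "a \<le> p i \<and> p i \<le> b" if "i \<le> n" for i
    using that by auto
  have "(\<Sum>i<n. \<bar>F (p (Suc i)) - F (p i)\<bar>) \<le> (\<Sum>i<n. L * (V (p (Suc i)) - V (p i)))"
    using p range by (intro sum_mono lip) (auto simp: mono_on_def)
  also have "\<dots> = L * (V (p n) - V (p 0))"
    using sum_lessThan_telescope[of "\<lambda>i. V (p i)" n] by (simp add: sum_distrib_left[symmetric])
  also have "\<dots> \<le> L * (V b - V a)"
    using range[of n] range[of 0] \<open>0 \<le> L\<close> mono_onD[OF V, of "p n" b] mono_onD[OF V, of a "p 0"]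
    by (intro mult_left_mono diff_mono) auto
  finally show "(\<Sum>i<n. \<bar>F (p (Suc i)) - F (p i)\<bar>) \<le> L * (V b - V a)" .
qed

section \<open>Change of clock by a distribution function\<close>

lemma non_atomic_singleton:
  assumes "non_atomic M" "{x} \<in> sets M"
  shows "emeasure M {x} = 0"
proof (rule ccontr)
  assume "emeasure M {x} \<noteq> 0"
  then have "measure_atom M {x}"
    using assms(2) by (auto simp: measure_atom_def zero_less_iff_neq_zero subset_singleton_iff)
  with assms(1) show False
    by (auto simp: non_atomic_def)
qed

text \<open>The probability integral transform, for measures of any finite mass: an atomless measure is carried to
  Lebesgue measure by its own distribution function. It suffices to compare the masses of rays,
  and \<open>{t. x < cdf M t}\<close> is the ray above the last point where the distribution function
  takes the value \<open>x\<close>; the bounded support guarantees such a point for \<open>x\<close> between \<open>0\<close> and the mass. The shift \<open>c\<close>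
  serves distribution functions that start at an earlier time.\<close>

lemma (in finite_borel_measure) distr_shifted_cdf:
  assumes atomless: "\<And>x. measure M {x} = 0"
    and "a \<le> b" and supp: "measure M {..a} = 0" "measure M {b<..} = 0"
  shows "distr M borel (\<lambda>t. c + cdf M t)
    = density lborel (indicator {c..c + measure M UNIV})"
proof -
  define m where "m = measure M UNIV"
  have space: "space M = UNIV"
    by (rule borel_UNIV)
  have [measurable_cong]: "sets M = sets borel"
    by (simp add: M_is_borel)
  have cont: "isCont (cdf M) x" for x
    by (simp add: isCont_cdf atomless)
  have [measurable]: "cdf M \<in> borel_measurable borel"
    using cont by (intro borel_measurable_continuous_onI continuous_at_imp_continuous_on) auto
  have cdf_a: "cdf M a = 0"
    using supp by (simp add: cdf_def)
  have tail: "measure M {t<..} = m - cdf M t" for t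
  proof -
    have "{t<..} = space M - {..t}"
      by (auto simp: space)
    then show ?thesis
      using finite_measure_compl[of "{..t}"] by (simp add: space m_def cdf_def M_is_borel)
  qed
  have cdf_b: "cdf M b = m"
    using supp tail[of b] by simp
  have cdf_bounds: "0 \<le> cdf M t" "cdf M t \<le> m" for t
    using cdf_nonneg[of t] tail[of t] measure_nonneg[of M "{t<..}"] by auto
  have level: "measure M {t. x < cdf M t} = m - x" if x: "0 \<le> x" "x < m" for x
  proof -
    let ?L = "{a..b} \<inter> cdf M -` {x}"
    have cont_ab: "continuous_on {a..b} (cdf M)"
      using cont by (auto intro: continuous_at_imp_continuous_on)
    then have "compact ?L"
      using continuous_closed_preimage[OF cont_ab closed_atLeastAtMost closed_singleton, of x]
      by (auto simp: compact_eq_bounded_closed intro: bounded_Int)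
    moreover have "?L \<noteq> {}"
      using IVT'[OF _ _ _ cont_ab, of x] cdf_a cdf_b x \<open>a \<le> b\<close> by auto
    ultimately obtain s where s: "s \<in> ?L" "\<And>t. t \<in> ?L \<Longrightarrow> t \<le> s"
      using compact_attains_sup[of ?L] by blast
    have "{t. x < cdf M t} = {s<..}"
    proof safe
      fix t assume "x < cdf M t"
      then show "s < t"
        using s(1) cdf_nondecreasing[of t s] by (cases "s < t") auto
    next
      fix t assume "s < t"
      show "x < cdf M t"
      proof (rule ccontr)
        assume "\<not> x < cdf M t"
        then have "cdf M t = x"
          using s(1) cdf_nondecreasing[of s t] \<open>s < t\<close> by auto
        moreover have "t \<le> b"
          using \<open>cdf M t = x\<close> cdf_b x cdf_nondecreasing[of b t] by (cases "t \<le> b") auto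
        ultimately have "t \<in> ?L"
          using s(1) \<open>s < t\<close> by simp
        then show False
          using s(2)[of t] \<open>s < t\<close> by simp
      qed
    qed
    then show ?thesis
      using tail[of s] s(1) by simp
  qed
  have "distr M borel (\<lambda>t. c + cdf M t) = density lborel (indicator {c..c + m})"
  proof (rule measure_eqI_lessThan)
    fix x
    have "emeasure (distr M borel (\<lambda>t. c + cdf M t)) {x<..}
        = ennreal (measure M {t. x - c < cdf M t})"
      by (subst emeasure_distr) (auto simp: space emeasure_eq_measure vimage_def algebra_simps)
    \<comment> \<open>\<open>x - c\<close> clipped to \<open>[0, m]\<close> is the mass of the complement of the ray.\<close>
    also have "\<dots> = ennreal (m - min m (max 0 (x - c)))"
    proof -
      consider "x < c" | "c \<le> x" "x - c < m" | "m \<le> x - c" "c \<le> x"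
        by linarith
      then show ?thesis
      proof cases
        case 1
        then have "x - c < cdf M t" for t
          using cdf_bounds(1)[of t] by linarith
        then have "{t. x - c < cdf M t} = UNIV"
          by auto
        then show ?thesis
          using 1 measure_nonneg[of M UNIV] by (simp add: m_def)
      next
        case 2
        then show ?thesis using level[of "x - c"] by simp
      next
        case 3
        then have "\<not> x - c < cdf M t" for t
          using cdf_bounds(2)[of t] by linarith
        then have "{t. x - c < cdf M t} = {}"
          by auto
        then show ?thesis
          using 3 by simp
      qed
    qed
    also have "\<dots> = emeasure (density lborel (indicator {c..c + m})) {x<..}"
    proof -
      have "emeasure (density lborel (indicator {c..c + m})) {x<..} = emeasure lborel ({c..c+m} \<inter> {x<..})"
        by (simp add: emeasure_density indicator_inter_arith[symmetric] )
      also have "{c..c + m} \<inter> {x<..} = (if x < c then {c..c + m} else {x<..c + m})"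
        by auto
      also have "emeasure lborel \<dots> = ennreal (m - min m (max 0 (x - c)))"
        using cdf_bounds[of b] cdf_b by (auto simp: min_def max_def)
      finally show ?thesis ..
    qed
    finally show "emeasure (distr M borel (\<lambda>t. c + cdf M t)) {x<..}
       = emeasure (density lborel (indicator {c..c + m})) {x<..}" .
    show "emeasure (distr M borel (\<lambda>t. c + cdf M t)) {x<..} < \<infinity>"
      by (subst emeasure_distr) (auto simp: emeasure_eq_measure)
  qed auto
  then show ?thesis
    by (simp add: m_def)
qed

lemma density_indicator_set_integral:
  fixes f :: "'a \<Rightarrow> real"
  assumes S: "S \<in> sets M" and f: "f \<in> borel_measurable M"
  shows "integrable (density M (indicator S)) f \<longleftrightarrow> set_integrable M S f"
    and "(\<integral>x. f x \<partial>density M (indicator S)) = (LINT x:S|M. f x)"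
proof -
  have eq: "density M (indicator S) = density M (\<lambda>x. ennreal (indicator S x))"
    by (simp add: ennreal_indicator)
  have ind: "(indicator S :: 'a \<Rightarrow> real) \<in> borel_measurable M"
    using S by simp
  show "integrable (density M (indicator S)) f \<longleftrightarrow> set_integrable M S f"
    unfolding eq set_integrable_def by (intro integrable_density f ind) simp
  show "(\<integral>x. f x \<partial>density M (indicator S)) = (LINT x:S|M. f x)"
    unfolding eq set_lebesgue_integral_def by (intro integral_density f ind) simp
qed

text \<open>Substitution \<open>v = V t\<close> in a Stieltjes integral. The measure is restricted to \<open>[a, b]\<close>, where its
  distribution function is \<open>V - V a\<close>.\<close>

lemma distribution_function_time_change:
  fixes \<mu> :: "real measure" and V h :: "real \<Rightarrow> real"
  assumes sets: "sets \<mu> = sets borel" and "a \<le> b"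
    and atomless: "\<And>x. emeasure \<mu> {x} = 0"
    and finite: "emeasure \<mu> {a..b} < \<infinity>"
    and V: "\<And>t. t \<in> {a..b} \<Longrightarrow> V t = V a + measure \<mu> {a..t}"
  shows "continuous_on {a..b} V"
    and "h \<in> borel_measurable borel \<Longrightarrow>
      set_integrable \<mu> {a..b} (\<lambda>t. h (V t)) \<longleftrightarrow> set_integrable lborel {V a..V b} h"
    and "h \<in> borel_measurable borel \<Longrightarrow>
      (LINT t:{a..b}|\<mu>. h (V t)) = (LINT v:{V a..V b}|lborel. h v)"
proof -
  define N where "N = density \<mu> (indicator {a..b})"
  have [simp, measurable_cong]: "sets \<mu> = sets borel" "sets N = sets borel"
    using sets by (simp_all add: N_def)
  have emN: "emeasure N A = emeasure \<mu> ({a..b} \<inter> A)" if "A \<in> sets borel" for A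
    using that unfolding N_def
    by (subst emeasure_density) (auto simp: indicator_inter_arith[symmetric])
  have measN: "measure N A = measure \<mu> ({a..b} \<inter> A)" if "A \<in> sets borel" for A
    using emN[OF that] by (simp add: measure_def)
  have spaceN: "space N = UNIV"
    using sets_eq_imp_space_eq[OF \<open>sets N = sets borel\<close>] by simp
  have "emeasure N (space N) = emeasure \<mu> {a..b}"
    using emN[of UNIV] by (simp add: spaceN)
  then interpret N: finite_borel_measure N
    using finite
    by (intro finite_borel_measure.intro finite_measureI finite_borel_measure_axioms.intro) auto
  have null: "measure \<mu> A = 0" if "A \<subseteq> {x}" for A x
  proof -
    have "A = {} \<or> A = {x}" using that by auto
    then show ?thesis using atomless[of x] by (auto simp: measure_def)
  qed
  have cdfN: "V t = V a + cdf N t" if "t \<in> {a..b}" for t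
  proof -
    have eq: "{a..b} \<inter> {..t} = {a..t}" using that by auto
    have "measure N {..t} = measure \<mu> {a..t}"
      unfolding eq[symmetric] by (rule measN) simp
    then show ?thesis
      using V[OF that] by (simp add: cdf_def)
  qed
  have atomN: "measure N {x} = 0" for x
    by (subst measN) (auto intro: null[of _ x])
  have "isCont (cdf N) x" for x
    by (simp add: N.isCont_cdf atomN)
  then have cont: "continuous_on A (cdf N)" for A
    by (intro continuous_at_imp_continuous_on) auto
  then have "continuous_on {a..b} (\<lambda>t. V a + cdf N t)"
    by (intro continuous_intros)
  then show "continuous_on {a..b} V"
    by (rule continuous_on_eq) (rule cdfN[symmetric])
  have [measurable]: "cdf N \<in> borel_measurable borel"
    using cont by (intro borel_measurable_continuous_onI)
  have "V b = V a + measure N UNIV"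
    using V[of b] \<open>a \<le> b\<close> by (simp add: measN)
  moreover have "distr N borel (\<lambda>t. V a + cdf N t)
      = density lborel (indicator {V a..V a + measure N UNIV})"
  proof (rule N.distr_shifted_cdf[OF atomN \<open>a \<le> b\<close>])
    have "{a..b} \<inter> {..a} \<subseteq> {a}" by auto
    then show "measure N {..a} = 0" by (subst measN) (auto intro: null[of _ a])
    have "{a..b} \<inter> {b<..} = {}" by auto
    then show "measure N {b<..} = 0" by (simp add: measN)
  qed
  ultimately have distr: "distr N borel (\<lambda>t. V a + cdf N t) = density lborel (indicator {V a..V b})"
    by simp
  assume [measurable]: "h \<in> borel_measurable borel"
  define f where "f = (\<lambda>t. h (V a + cdf N t))"
  have f [measurable]: "f \<in> borel_measurable borel"
    unfolding f_def by measurable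
  have hV: "h (V t) = f t" if "t \<in> {a..b}" for t
    unfolding f_def using cdfN[OF that] by (rule arg_cong)
  have "set_integrable \<mu> {a..b} (\<lambda>t. h (V t)) \<longleftrightarrow> set_integrable \<mu> {a..b} f"
    by (rule set_integrable_cong) (use hV in auto)
  also have "\<dots> \<longleftrightarrow> integrable N f"
    unfolding N_def by (intro density_indicator_set_integral(1)[symmetric]) auto
  also have "\<dots> \<longleftrightarrow> integrable (distr N borel (\<lambda>t. V a + cdf N t)) h"
    unfolding f_def by (intro integrable_distr_eq[symmetric]) auto
  also have "\<dots> \<longleftrightarrow> set_integrable lborel {V a..V b} h"
    unfolding distr by (intro density_indicator_set_integral(1)) auto
  finally show "set_integrable \<mu> {a..b} (\<lambda>t. h (V t)) \<longleftrightarrow> set_integrable lborel {V a..V b} h" .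
  have "(LINT t:{a..b}|\<mu>. h (V t)) = (LINT t:{a..b}|\<mu>. f t)"
    by (rule set_lebesgue_integral_cong) (use hV in auto)
  also have "\<dots> = (\<integral>t. f t \<partial>N)"
    unfolding N_def by (intro density_indicator_set_integral(2)[symmetric]) auto
  also have "\<dots> = (\<integral>v. h v \<partial>distr N borel (\<lambda>t. V a + cdf N t))"
    unfolding f_def by (intro integral_distr[symmetric]) auto
  also have "\<dots> = (LINT v:{V a..V b}|lborel. h v)"
    unfolding distr by (intro density_indicator_set_integral(2)) auto
  finally show "(LINT t:{a..b}|\<mu>. h (V t)) = (LINT v:{V a..V b}|lborel. h v)" .
qed

section \<open>The law of generalized Brownian motion at a fixed time\<close>

text \<open>The second moment decides which case holds, since a centred constant is \<open>0\<close> almost surely.\<close>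

lemma (in prob_space) centred_gaussian_cases:
  assumes X: "gaussian_rv M X" and mean: "expectation X = 0" and var: "expectation (\<lambda>\<omega>. X \<omega> * X \<omega>) = s"
  shows "s = 0 \<and> (AE \<omega> in M. X \<omega> = 0) \<or>
    0 < s \<and> distributed M lborel X (normal_density 0 (sqrt s))"
proof -
  have [measurable]: "X \<in> borel_measurable M"
    using X by (simp add: gaussian_rv_def)
  consider m where "AE \<omega> in M. X \<omega> = m"
    | m \<sigma> where "0 < \<sigma>" "distributed M lborel X (normal_density m \<sigma>)"
    using X unfolding gaussian_rv_def by blast
  then show ?thesis
  proof cases
    case 1
    have "expectation X = expectation (\<lambda>_. m)"
      by (rule integral_cong_AE) (use 1 in auto)
    then have "m = 0"
      using mean by (simp add: prob_space)
    then have X0: "AE \<omega> in M. X \<omega> = 0"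
      using 1 by simp
    have "expectation (\<lambda>\<omega>. X \<omega> * X \<omega>) = expectation (\<lambda>_. 0)"
      by (rule integral_cong_AE) (use X0 in auto)
    then show ?thesis
      using var X0 by simp
  next
    case 2
    then have "m = 0"
      using normal_distributed_expectation mean by auto
    then have "s = \<sigma>\<^sup>2"
      using normal_distributed_variance[OF 2] mean var by (simp add: power2_eq_square)
    then show ?thesis
      using 2 \<open>m = 0\<close> by simp
  qed
qed

lemma (in prob_space) expectation_shifted_gaussian:
  assumes X: "s = 0 \<and> (AE \<omega> in M. X \<omega> = 0) \<or>
      0 < s \<and> distributed M lborel X (normal_density 0 (sqrt s))"
    and Y: "AE \<omega> in M. Y \<omega> = x + X \<omega>"
    and phi [measurable]: "\<phi> \<in> borel_measurable borel"
    and int: "integrable M (\<lambda>\<omega>. \<phi> (Y \<omega>))"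
  shows "expectation (\<lambda>\<omega>. \<phi> (Y \<omega>)) = heat_flow \<phi> s x"
    and "0 < s \<Longrightarrow> integrable lborel (\<lambda>y. \<phi> y * heat_kernel s (y - x))"
proof -
  have meas: "(\<lambda>\<omega>. \<phi> (Y \<omega>)) \<in> borel_measurable M"
    using int by simp
  have *: "expectation (\<lambda>\<omega>. \<phi> (Y \<omega>)) = heat_flow \<phi> s x \<and>
    (0 < s \<longrightarrow> integrable lborel (\<lambda>y. \<phi> y * heat_kernel s (y - x)))"
  proof (cases "s = 0")
    case True
    then have "AE \<omega> in M. X \<omega> = 0"
      using X by simp
    with Y have "AE \<omega> in M. \<phi> (Y \<omega>) = \<phi> x"
      by eventually_elim simp
    then have "expectation (\<lambda>\<omega>. \<phi> (Y \<omega>)) = expectation (\<lambda>_. \<phi> x)"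
      by (intro integral_cong_AE meas) auto
    then show ?thesis
      using True by (simp add: heat_flow_def prob_space)
  next
    case False
    then have s: "0 < s" and D0: "distributed M lborel X (normal_density 0 (sqrt s))"
      using X by auto
    have D: "distributed M lborel (\<lambda>\<omega>. x + X \<omega>) (normal_density x (sqrt s))"
      using normal_density_affine[OF D0, of 1 x] s by simp
    have [measurable]: "X \<in> borel_measurable M"
      using distributed_measurable[OF D0] by simp
    have shift_meas: "(\<lambda>\<omega>. \<phi> (x + X \<omega>)) \<in> borel_measurable M"
      by measurable
    have eq: "AE \<omega> in M. \<phi> (Y \<omega>) = \<phi> (x + X \<omega>)"
      using Y by eventually_elim simp
    have "integrable M (\<lambda>\<omega>. \<phi> (x + X \<omega>))"
      using int integrable_cong_AE[OF meas shift_meas eq] by simp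
    then have "integrable lborel (\<lambda>y. normal_density x (sqrt s) y * \<phi> y)"
      by (subst distributed_integrable[OF D]) auto
    moreover have "expectation (\<lambda>\<omega>. \<phi> (Y \<omega>)) = (\<integral>y. normal_density x (sqrt s) y * \<phi> y \<partial>lborel)"
      using integral_cong_AE[OF meas shift_meas eq] distributed_integral[OF D, of \<phi>] by simp
    ultimately show ?thesis
      using s by (simp add: normal_density_eq_heat_kernel heat_flow_def mult.commute)
  qed
  then show "expectation (\<lambda>\<omega>. \<phi> (Y \<omega>)) = heat_flow \<phi> s x"
    and "0 < s \<Longrightarrow> integrable lborel (\<lambda>y. \<phi> y * heat_kernel s (y - x))"
    by auto
qed

text \<open>The path at time \<open>t\<close> is almost surely \<open>x + W A\<close> with \<open>A = [0, t] \<inter> J\<close>. This is a Gaussian variable of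
  variance \<open>\<mu> A\<close>, which equals \<open>\<mu> [0, t]\<close> as \<open>\<mu>\<close> lives on \<open>J\<close>. So time enters only through the clock
  \<open>\<mu> [0, t]\<close>.\<close>

lemma generalized_brownian_motion_expectation:
  assumes gbm: "generalized_brownian_motion \<mu> (time_interval \<alpha>) W P"
    and borel: "sets \<mu> = sets borel"
    and supported: "emeasure \<mu> (- time_interval \<alpha>) = 0"
    and finite: "emeasure \<mu> {0..t} < \<infinity>"
    and t: "0 \<le> t"
    and phi: "\<phi> \<in> borel_measurable borel"
    and int: "integrable (P x) (\<lambda>\<omega>. \<phi> (\<omega> t))"
  shows "transition_op P t \<phi> x = heat_flow \<phi> (measure \<mu> {0..t}) x"
    and "0 < measure \<mu> {0..t} \<Longrightarrow>
      integrable lborel (\<lambda>y. \<phi> y * heat_kernel (measure \<mu> {0..t}) (y - x))"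
proof -
  define J where "J = time_interval \<alpha>"
  define A where "A = {0..t} \<inter> J"
  have J: "J \<in> sets borel"
    unfolding J_def time_interval_def by measurable
  define \<A> where "\<A> = {A \<in> sets borel. A \<subseteq> J \<and> emeasure \<mu> A < \<infinity>}"
  have "emeasure \<mu> A \<le> emeasure \<mu> {0..t}"
    using borel by (intro emeasure_mono) (auto simp: A_def)
  with J finite have A: "A \<in> \<A>"
    by (auto simp: \<A>_def A_def)
  have "AE s in \<mu>. s \<in> J"
    by (rule AE_I[of _ _ "- J"]) (use supported J borel in \<open>auto simp: J_def\<close>)
  then have meas_A: "measure \<mu> (A \<inter> A) = measure \<mu> {0..t}"
    by (intro measure_eq_AE) (use J borel in \<open>auto simp: A_def\<close>)
  note g = gbm[unfolded generalized_brownian_motion_def Let_def, folded J_def, folded \<A>_def,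
      THEN spec, of x]
  interpret prob_space "P x"
    using g by (rule conjunct1)
  have process: "gaussian_process (P x) \<A> W"
    and mean: "\<And>A. A \<in> \<A> \<Longrightarrow> expectation (W A) = 0"
    and covariance: "\<And>A B. A \<in> \<A> \<Longrightarrow> B \<in> \<A> \<Longrightarrow>
      expectation (\<lambda>\<omega>. W A \<omega> * W B \<omega>) = measure \<mu> (A \<inter> B)"
    and increment: "\<And>s t. 0 \<le> s \<Longrightarrow> s \<le> t \<Longrightarrow> AE \<omega> in P x. W ({s..t} \<inter> J) \<omega> = \<omega> t - \<omega> s"
    and start: "AE \<omega> in P x. \<omega> 0 = x"
    using g by blast+
  have "gaussian_rv (P x) (\<lambda>\<omega>. \<Sum>i\<in>{A}. 1 * W i \<omega>)"
    using process[unfolded gaussian_process_def, THEN spec, of "{A}", THEN spec, of "\<lambda>_. 1"] A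
    by simp
  then have "gaussian_rv (P x) (W A)"
    by simp
  moreover have "expectation (W A) = 0"
    using mean[OF A] .
  moreover have "expectation (\<lambda>\<omega>. W A \<omega> * W A \<omega>) = measure \<mu> {0..t}"
    using covariance[OF A A] meas_A by simp
  ultimately have law: "measure \<mu> {0..t} = 0 \<and> (AE \<omega> in P x. W A \<omega> = 0) \<or>
     0 < measure \<mu> {0..t} \<and> distributed (P x) lborel (W A) (normal_density 0 (sqrt (measure \<mu> {0..t})))"
    by (rule centred_gaussian_cases)
  have "AE \<omega> in P x. W A \<omega> = \<omega> t - \<omega> 0"
    unfolding A_def by (rule increment[OF order_refl t])
  with start have "AE \<omega> in P x. \<omega> t = x + W A \<omega>"
    by eventually_elim simp
  from expectation_shifted_gaussian[OF law this phi int]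
  show "transition_op P t \<phi> x = heat_flow \<phi> (measure \<mu> {0..t}) x"
    and "0 < measure \<mu> {0..t} \<Longrightarrow>
      integrable lborel (\<lambda>y. \<phi> y * heat_kernel (measure \<mu> {0..t}) (y - x))"
    by (simp_all add: transition_op_def)
qed

section \<open>The heat equation in the clock of the measure\<close>

lemma heat_flow_dxx_measurable:
  assumes [measurable]: "\<phi> \<in> borel_measurable borel"
  shows "(\<lambda>v. heat_flow_dxx \<phi> v x) \<in> borel_measurable borel"
  unfolding heat_flow_dxx_def heat_kernel_dxx_def by measurable

text \<open>The integral is the gauge integral. For it the fundamental theorem of calculus needs no
  integrability of the derivative, so the starting point may be \<open>y = 0\<close>, where
  \<open>heat_flow_dxx\<close> may blow up.\<close>

lemma heat_flow_has_integral:
  assumes conv: "0 < V \<Longrightarrow> heat_convolvable \<phi> V" and "isCont \<phi> x"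
    and yz: "0 \<le> y" "y \<le> z" "z \<le> V"
    and h: "\<And>v. 0 < v \<Longrightarrow> v \<le> V \<Longrightarrow> h v = heat_flow_dxx \<phi> v x / 2"
  shows "(h has_integral (heat_flow \<phi> z x - heat_flow \<phi> y x)) {y..z}"
proof (cases "y = z")
  case True
  then show ?thesis by (simp add: has_integral_refl)
next
  case False
  then have conv: "heat_convolvable \<phi> V"
    using yz conv by simp
  show ?thesis
  proof (rule fundamental_theorem_of_calculus_interior[OF \<open>y \<le> z\<close>])
    show "continuous_on {y..z} (\<lambda>v. heat_flow \<phi> v x)"
      using heat_flow_continuous_on[OF conv \<open>isCont \<phi> x\<close>] yz by (auto intro: continuous_on_subset)
    fix v assume v: "v \<in> {y<..<z}"
    then have at: "at v within {v/2..V} = at v"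
      using yz by (intro at_within_interior) auto
    have hv: "h v = heat_flow_dxx \<phi> v x / 2"
      using v yz by (intro h) auto
    show "((\<lambda>v. heat_flow \<phi> v x) has_vector_derivative h v) (at v)"
      unfolding hv using at heat_flow_has_derivative_v[OF conv, of "v/2" v x] v yz
      by (simp add: has_real_derivative_iff_has_vector_derivative)
  qed
qed

text \<open>Let \<open>V t = \<mu> [0, t]\<close>. The integrand \<open>g\<close> factors as \<open>h \<circ> V\<close>. In the variable \<open>v\<close> the gauge integral of \<open>h\<close>
  is the increment of the flow, and bounded variation of the flow makes it a Lebesgue integral. The
  substitution \<open>v = V t\<close> then carries both integrability and value back to \<open>\<mu>\<close>.\<close>

lemma heat_flow_nabla:
  assumes sets: "sets \<mu> = sets borel" and ab: "0 \<le> a" "a \<le> b"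
    and atomless: "\<And>x. emeasure \<mu> {x} = 0"
    and finite: "\<And>t. emeasure \<mu> {0..t} < \<infinity>"
    and phi: "\<phi> \<in> borel_measurable borel" "isCont \<phi> x"
    and conv: "0 < measure \<mu> {0..b} \<Longrightarrow> heat_convolvable \<phi> (measure \<mu> {0..b})"
    and bv: "bounded_variation_on_interval (\<lambda>t. heat_flow \<phi> (measure \<mu> {0..t}) x) a b"
  defines "g \<equiv> \<lambda>t. 1 / 2 * deriv (deriv (heat_flow \<phi> (measure \<mu> {0..t}))) x"
  shows "set_integrable \<mu> {a..b} g"
    and "heat_flow \<phi> (measure \<mu> {0..b}) x - heat_flow \<phi> (measure \<mu> {0..a}) x = (LINT t:{a..b}|\<mu>. g t)"
proof -
  define V where "V t = measure \<mu> {0..t}" for t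
  define F where "F v = heat_flow \<phi> v x" for v
  \<comment> \<open>While \<open>V t = 0\<close> the flow is \<open>\<phi>\<close> itself, which need not be differentiable. Whatever value \<open>deriv\<close>
    takes there is the same for all such \<open>t\<close>, so \<open>g\<close> still factors through \<open>V\<close>.\<close>
  define h where "h v = (if v = 0 then 1 / 2 * deriv (deriv (heat_flow \<phi> 0)) x
    else heat_flow_dxx \<phi> v x / 2)" for v
  have h_meas: "h \<in> borel_measurable borel"
    unfolding h_def using heat_flow_dxx_measurable[OF phi(1), of x] by measurable
  have V_mono: "V s \<le> V t" if "s \<le> t" for s t
    unfolding V_def measure_def using that finite[of t] sets
    by (intro enn2real_mono emeasure_mono) auto
  have fin_ab: "emeasure \<mu> {a..b} < \<infinity>"
    using finite[of b] emeasure_mono[of "{a..b}" "{0..b}" \<mu>] ab sets by (auto intro: le_less_trans)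
  have V_eq: "V t = V a + measure \<mu> {a..t}" if "t \<in> {a..b}" for t
  proof -
    have split: "{0..t} = {0..a} \<union> {a<..t}"
      using that ab by auto
    have "emeasure \<mu> {a<..t} \<le> emeasure \<mu> {0..t}"
      using ab sets by (intro emeasure_mono) auto
    then have "emeasure \<mu> {a<..t} < \<infinity>"
      using finite[of t] by (rule le_less_trans)
    then have "V t = V a + measure \<mu> {a<..t}"
      unfolding V_def split using finite[of a] sets by (intro measure_Union) auto
    also have "measure \<mu> {a<..t} = measure \<mu> {a..t}"
    proof (rule measure_eq_AE)
      have "AE s in \<mu>. s \<noteq> a"
        by (rule AE_I[of _ _ "{a}"]) (use atomless sets in auto)
      then show "AE s in \<mu>. (s \<in> {a<..t}) = (s \<in> {a..t})"
        by eventually_elim auto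
    qed (use sets in auto)
    finally show ?thesis .
  qed
  have V_cont: "continuous_on {a..b} V"
    by (rule distribution_function_time_change(1)[OF sets ab(2) atomless fin_ab V_eq])
  have tc: "set_integrable \<mu> {a..b} (\<lambda>t. h (V t)) \<longleftrightarrow> set_integrable lborel {V a..V b} h"
    "(LINT t:{a..b}|\<mu>. h (V t)) = (LINT v:{V a..V b}|lborel. h v)"
    by (rule distribution_function_time_change(2,3)[OF sets ab(2) atomless fin_ab V_eq h_meas];
        assumption)+
  have int: "(h has_integral (F z - F y)) {y..z}" if "V a \<le> y" "y \<le> z" "z \<le> V b" for y z
    unfolding F_def
  proof (rule heat_flow_has_integral[OF _ phi(2)])
    show "0 \<le> y"
      using that(1) unfolding V_def by (rule order_trans[OF measure_nonneg])
  qed (use that conv in \<open>auto simp: h_def V_def\<close>)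
  have g: "g t = h (V t)" if "t \<in> {a..b}" for t
  proof (cases "V t = 0")
    case True
    then show ?thesis by (simp add: g_def h_def V_def)
  next
    case False
    then have "0 < V t" "V t \<le> V b"
      using V_mono[of t b] that measure_nonneg[of \<mu> "{0..t}"] by (auto simp: V_def less_le)
    then show ?thesis
      using heat_flow_twice_differentiable(3)[OF conv, of "V t" x]
      by (simp add: g_def h_def V_def)
  qed
  have "bounded_variation_on_interval F (V a) (V b)"
    using bv V_mono by (intro bounded_variation_time_change[OF ab(2) V_cont])
      (auto simp: mono_on_def F_def V_def)
  with V_mono[OF ab(2)] int have "h absolutely_integrable_on {V a..V b}"
    by (rule absolutely_integrable_if_bounded_variation)
  then have h_int: "set_integrable lborel {V a..V b} h"
    using h_meas by (simp add: set_integrable_def integrable_completion)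
  then have "set_integrable \<mu> {a..b} (\<lambda>t. h (V t))"
    using tc(1) by (rule iffD2[rotated])
  then show "set_integrable \<mu> {a..b} g"
    by (rule iffD1[OF set_integrable_cong, rotated -1]) (use g in auto)
  have "F (V b) - F (V a) = integral {V a..V b} h"
    by (rule integral_unique[OF int[OF order_refl V_mono[OF ab(2)] order_refl], symmetric])
  also have "\<dots> = (LINT v:{V a..V b}|lborel. h v)"
    by (rule set_borel_integral_eq_integral(2)[OF h_int, symmetric])
  also have "\<dots> = (LINT t:{a..b}|\<mu>. h (V t))"
    by (rule tc(2)[symmetric])
  also have "\<dots> = (LINT t:{a..b}|\<mu>. g t)"
    by (rule set_lebesgue_integral_cong) (use g sets in auto)
  finally show "heat_flow \<phi> (measure \<mu> {0..b}) x - heat_flow \<phi> (measure \<mu> {0..a}) x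
      = (LINT t:{a..b}|\<mu>. g t)"
    by (simp add: F_def V_def)
qed

text \<open>Away from variance \<open>0\<close> the heat equation bounds the \<open>v\<close>-derivative, so the flow is Lipschitz in \<open>V\<close>.\<close>

lemma heat_flow_bounded_variation:
  assumes conv: "heat_convolvable \<phi> (V b)" and "a \<le> b"
    and V: "mono_on {a..b} V" "0 < V a"
  shows "bounded_variation_on_interval (\<lambda>t. heat_flow \<phi> (V t) x) a b"
proof -
  obtain L where L: "\<And>v. V a \<le> v \<Longrightarrow> v \<le> V b \<Longrightarrow> \<bar>heat_flow_dxx \<phi> v x\<bar> \<le> L"
    using heat_flow_dxx_bounded[OF conv V(2)] by metis
  have "V a \<le> V b"
    using V \<open>a \<le> b\<close> by (auto intro: mono_onD)
  then have "0 \<le> L"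
    using L[of "V a"] by auto
  show ?thesis
  proof (rule bounded_variation_if_lipschitz_time_change[where L = "L / 2", OF _ V(1)])
    fix s t assume st: "a \<le> s" "s \<le> t" "t \<le> b"
    then have Vst: "V a \<le> V s" "V s \<le> V t" "V t \<le> V b"
      using \<open>a \<le> b\<close> by (auto intro: mono_onD[OF V(1)])
    have "norm (heat_flow \<phi> (V t) x - heat_flow \<phi> (V s) x) \<le> L / 2 * norm (V t - V s)"
    proof (rule field_differentiable_bound[of "{V a..V b}"])
      show "((\<lambda>v. heat_flow \<phi> v x) has_field_derivative heat_flow_dxx \<phi> v x / 2)
          (at v within {V a..V b})" if "v \<in> {V a..V b}" for v
        using that V by (intro heat_flow_has_derivative_v[OF conv]) auto
    qed (use L Vst in auto)
    then show "\<bar>heat_flow \<phi> (V t) x - heat_flow \<phi> (V s) x\<bar> \<le> L / 2 * (V t - V s)"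
      using Vst by simp
  qed (use \<open>0 \<le> L\<close> in auto)
qed

theorem theorem3p30:
  fixes \<mu> :: "real measure" and \<alpha> :: ereal
    and W :: "real set \<Rightarrow> (real \<Rightarrow> real) \<Rightarrow> real"
    and P :: "real \<Rightarrow> (real \<Rightarrow> real) measure"
    and \<phi> :: "real \<Rightarrow> real"
    and u :: "real \<Rightarrow> real \<Rightarrow> real"
  assumes alpha: "0 \<le> \<alpha>"
    and borel: "sets \<mu> = sets borel"
    and sigma_finite: "sigma_finite_measure \<mu>"
    and non_atomic: "non_atomic \<mu>"
    and supported: "emeasure \<mu> (- time_interval \<alpha>) = 0"
    and locally_finite: "\<And>t. emeasure \<mu> {0..t} < \<infinity>"
    and gbm: "generalized_brownian_motion \<mu> (time_interval \<alpha>) W P"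
    and phi_cont: "continuous_on UNIV \<phi>"
    and phi_integrable: "\<And>t x. 0 \<le> t \<Longrightarrow> integrable (P x) (\<lambda>\<omega>. \<phi> (\<omega> t))"
    and u: "\<And>t x. u t x = transition_op P t \<phi> x"
  shows "(\<forall>t\<ge>0. 0 < emeasure \<mu> {0..t} \<longrightarrow>
            (\<forall>x. u t differentiable (at x) \<and> deriv (u t) differentiable (at x)))
       \<and> (\<forall>x. locally_bounded_variation_on (\<lambda>t. u t x) {t. 0 \<le> t \<and> 0 < emeasure \<mu> {0..t}})
       \<and> (\<forall>x I. is_interval I \<and> I \<subseteq> {0..} \<and> locally_bounded_variation_on (\<lambda>t. u t x) I \<longrightarrow>
            has_nabla \<mu> I (\<lambda>t. u t x) (\<lambda>t. 1 / 2 * deriv (deriv (u t)) x))"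
proof -
  define V where "V t = measure \<mu> {0..t}" for t
  have phi_meas: "\<phi> \<in> borel_measurable borel"
    using phi_cont by (rule borel_measurable_continuous_onI)
  have phi_isCont: "isCont \<phi> x" for x
    using phi_cont by (simp add: continuous_on_eq_continuous_at)
  have atomless: "emeasure \<mu> {x} = 0" for x
    using non_atomic borel by (intro non_atomic_singleton) auto
  note law = generalized_brownian_motion_expectation[OF gbm borel supported locally_finite _ phi_meas phi_integrable]
  have u_eq: "u t = heat_flow \<phi> (V t)" if "0 \<le> t" for t
    using law(1)[OF that that] by (simp add: fun_eq_iff u V_def)
  have conv: "heat_convolvable \<phi> (V t)" if "0 \<le> t" "0 < V t" for t
    using law(2)[OF that(1) that(1)] that(2) phi_meas by (simp add: heat_convolvable_def V_def)
  have V_pos: "0 < emeasure \<mu> {0..t} \<longleftrightarrow> 0 < V t" for t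
    using locally_finite[of t] unfolding V_def measure_def
    by (simp add: enn2real_positive_iff)
  have V_mono: "mono_on A V" for A
    unfolding V_def measure_def using locally_finite borel
    by (intro mono_onI enn2real_mono emeasure_mono) auto
  show ?thesis
  proof (intro conjI allI impI)
    fix t x :: real assume "0 \<le> t" "0 < emeasure \<mu> {0..t}"
    then show "u t differentiable (at x)" "deriv (u t) differentiable (at x)"
      using heat_flow_twice_differentiable[OF conv] by (auto simp: u_eq V_pos)
  next
    fix x
    show "locally_bounded_variation_on (\<lambda>t. u t x) {t. 0 \<le> t \<and> 0 < emeasure \<mu> {0..t}}"
      unfolding locally_bounded_variation_on_def
    proof (intro allI impI)
      fix a b assume "a \<le> b \<and> {a..b} \<subseteq> {t. 0 \<le> t \<and> 0 < emeasure \<mu> {0..t}}"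
      then have ab: "a \<le> b" "0 \<le> a" "0 < V a" "0 < V b"
        by (auto simp: V_pos subset_iff)
      have "bounded_variation_on_interval (\<lambda>t. heat_flow \<phi> (V t) x) a b"
        using ab by (intro heat_flow_bounded_variation conv V_mono) auto
      then show "bounded_variation_on_interval (\<lambda>t. u t x) a b"
        by (rule bounded_variation_on_interval_cong) (use ab u_eq in auto)
    qed
  next
    fix x I assume I: "is_interval I \<and> I \<subseteq> {0..} \<and> locally_bounded_variation_on (\<lambda>t. u t x) I"
    show "has_nabla \<mu> I (\<lambda>t. u t x) (\<lambda>t. 1 / 2 * deriv (deriv (u t)) x)"
      unfolding has_nabla_def
    proof (intro conjI allI impI)
      show "locally_bounded_variation_on (\<lambda>t. u t x) I"
        using I by simp
      fix a b assume ab: "a \<le> b \<and> {a..b} \<subseteq> I"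
      then have "0 \<le> a" "a \<le> b"
        using I by auto
      have "bounded_variation_on_interval (\<lambda>t. u t x) a b"
        using I ab by (auto simp: locally_bounded_variation_on_def)
      then have "bounded_variation_on_interval (\<lambda>t. heat_flow \<phi> (V t) x) a b"
        by (rule bounded_variation_on_interval_cong) (use \<open>0 \<le> a\<close> u_eq in auto)
      note nabla = heat_flow_nabla[OF borel \<open>0 \<le> a\<close> \<open>a \<le> b\<close> atomless locally_finite phi_meas phi_isCont
          conv[unfolded V_def] this[unfolded V_def]]
      show "set_integrable \<mu> {a..b} (\<lambda>t. 1 / 2 * deriv (deriv (u t)) x)"
      proof (subst set_integrable_cong)
        show "set_integrable \<mu> {a..b} (\<lambda>t. 1 / 2 * deriv (deriv (heat_flow \<phi> (measure \<mu> {0..t}))) x)"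
          using \<open>0 \<le> a\<close> \<open>a \<le> b\<close> by (intro nabla) auto
      qed (use \<open>0 \<le> a\<close> u_eq in \<open>auto simp: V_def\<close>)
      have "u b x - u a x = heat_flow \<phi> (V b) x - heat_flow \<phi> (V a) x"
        using \<open>0 \<le> a\<close> \<open>a \<le> b\<close> by (simp add: u_eq)
      also have "\<dots> = (LINT t:{a..b}|\<mu>. 1 / 2 * deriv (deriv (heat_flow \<phi> (measure \<mu> {0..t}))) x)"
        unfolding V_def using \<open>0 \<le> a\<close> \<open>a \<le> b\<close> by (intro nabla) auto
      also have "\<dots> = (LINT t:{a..b}|\<mu>. 1 / 2 * deriv (deriv (u t)) x)"
        by (rule set_lebesgue_integral_cong) (use \<open>0 \<le> a\<close> u_eq borel in \<open>auto simp: V_def\<close>)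
      finally show "u b x - u a x = (LINT t:{a..b}|\<mu>. 1 / 2 * deriv (deriv (u t)) x)" .
    qed
  qed
qed

end
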